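(* Let $k\ge 2$ be an integer and let $A_0(z),A_1(z),\dots,A_{k-1}(z)$ be entire functions such that $$\sigma_{(\alpha,\beta,\gamma)}[A_0]>\max\{\sigma_{(\alpha,\beta,\gamma)}[A_j] : j=1,\dots,k-1\}.$$ Then every solution $f\not\equiv 0$ of $$f^{(k)}+A_{k-1}(z)f^{(k-1)}+\cdots+A_1(z)f'+A_0(z)f=0$$ satisfies $\sigma_{(\alpha(\log),\beta,\gamma)}[f]=\sigma_{(\alpha,\beta,\gamma)}[A_0]$.
   Context: Notation: $\log^{[0]}x=x$, $\log^{[p]}x=\log(\log^{[p-1]}x)$. Let $L$ be the class of continuous non-negative functions $\alpha$ on $(-\infty,+\infty)$ such that, for some $x_0$, $\alpha(x)=\alpha(x_0)\ge 0$ for $x\le x_0$ and $\alpha(x)$ increases to $+\infty$ as $x_0\le x\to+\infty$. Write $\alpha\in L_1$ if $\alpha\in L$ and $\alpha(a+b)\le\alpha(a)+\alpha(b)+c$ for all $a,b\ge R_0$ and some fixed $c\in(0,+\infty)$; $\alpha\in L_2$ if $\alpha\in L$ and $\alpha(x+O(1))=(1+o(1))\alpha(x)$ as $x\to+\infty$; $\alpha\in L_3$ if $\alpha\in L$ and $\alpha(a+b)\le\alpha(a)+\alpha(b)$ for all $a,b\ge R_0$. Standing assumptions on $\alpha,\beta,\gamma$: (i) $\alpha\in L_1$, $\beta\in L_2$, $\gamma\in L_3$; (ii) as $x\to+\infty$: $\alpha(\log^{[p]}x)=o(\beta(\log\gamma(x)))$ for $p\ge 2$, $\alpha(\log x)=o(\alpha(x))$,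 and $\alpha^{-1}(\kappa x)=o(\alpha^{-1}(x))$ for $0<\kappa<1$. For a meromorphic function $f$ on $\mathbb{C}$ with Nevanlinna characteristic $T(r,f)$, the $(\alpha,\beta,\gamma)$-order and the $(\alpha(\log),\beta,\gamma)$-order are $$\sigma_{(\alpha,\beta,\gamma)}[f]=\limsup_{r\to+\infty}\frac{\alpha(\log T(r,f))}{\beta(\log\gamma(r))},\qquad \sigma_{(\alpha(\log),\beta,\gamma)}[f]=\limsup_{r\to+\infty}\frac{\alpha(\log^{[2]}T(r,f))}{\beta(\log\gamma(r))}.$$ *)

theory Defs
  imports "HOL-Complex_Analysis.Complex_Analysis" "HOL-Library.Landau_Symbols"
begin

section \<open>Nevanlinna characteristic of a meromorphic function\<close>

definition nevanlinna_m :: "real \<Rightarrow> (complex \<Rightarrow> complex) \<Rightarrow> real" where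
  "nevanlinna_m r f =
     1 / (2 * pi) * integral {0..2 * pi} (\<lambda>t. max 0 (ln (norm (f (of_real r * cis t)))))"

text \<open>The number of poles in the closed disc of radius \<open>t\<close>, counted with multiplicity; at a pole,
  \<^const>\<open>zorder\<close> is minus the multiplicity.\<close>

definition nevanlinna_n :: "real \<Rightarrow> (complex \<Rightarrow> complex) \<Rightarrow> nat" where
  "nevanlinna_n t f = (\<Sum>z\<in>{z. is_pole f z \<and> norm z \<le> t}. nat (- zorder f z))"

definition nevanlinna_N :: "real \<Rightarrow> (complex \<Rightarrow> complex) \<Rightarrow> real" where
  "nevanlinna_N r f =
     integral {0..r} (\<lambda>t. (real (nevanlinna_n t f) - real (nevanlinna_n 0 f)) / t)
     + real (nevanlinna_n 0 f) * ln r"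

definition nevanlinna_T :: "real \<Rightarrow> (complex \<Rightarrow> complex) \<Rightarrow> real" where
  "nevanlinna_T r f = nevanlinna_m r f + nevanlinna_N r f"

section \<open>The classes of growth scales\<close>

text \<open>``Increases'' is read strictly on \<open>[x\<^sub>0, \<infinity>)\<close>, as the use of the inverse
  function requires.  Since the function is constant to the left of \<open>x\<^sub>0\<close>, every value above
  its minimum has exactly one preimage, so \<^term>\<open>inv \<alpha>\<close> is the intended inverse there.\<close>

definition class_L :: "(real \<Rightarrow> real) set" where
  "class_L = {\<alpha>. continuous_on UNIV \<alpha> \<and> (\<forall>x. \<alpha> x \<ge> 0) \<and>
     (\<exists>x0. (\<forall>x\<le>x0. \<alpha> x = \<alpha> x0) \<and> strict_mono_on {x0..} \<alpha>) \<and>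
     filterlim \<alpha> at_top at_top}"

definition class_L1 :: "(real \<Rightarrow> real) set" where
  "class_L1 = {\<alpha> \<in> class_L. \<exists>c>0. \<exists>R0. \<forall>a\<ge>R0. \<forall>b\<ge>R0. \<alpha> (a + b) \<le> \<alpha> a + \<alpha> b + c}"

definition class_L2 :: "(real \<Rightarrow> real) set" where
  "class_L2 = {\<alpha> \<in> class_L. \<forall>h \<in> O[at_top](\<lambda>_. 1 :: real).
     (\<lambda>x. \<alpha> (x + h x)) \<sim>[at_top] \<alpha>}"

definition class_L3 :: "(real \<Rightarrow> real) set" where
  "class_L3 = {\<alpha> \<in> class_L. \<exists>R0. \<forall>a\<ge>R0. \<forall>b\<ge>R0. \<alpha> (a + b) \<le> \<alpha> a + \<alpha> b}"

section \<open>Generalized orders\<close>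

text \<open>The library's \<^term>\<open>ln x\<close> is a total function, with junk values for \<open>x \<le> 0\<close>.  For a
  meromorphic function the characteristic tends to infinity unless the function is constant, so
  junk occurs for arbitrarily large \<open>r\<close> only for constants.  Then the numerators below do not
  depend on \<open>r\<close>, whereas the denominators tend to infinity for \<^prop>\<open>\<beta> \<in> class_L\<close> and
  \<^prop>\<open>\<gamma> \<in> class_L\<close>: the orders are \<open>0\<close>, just as with the convention that \<open>\<alpha>\<close> takes its
  minimum at \<open>log 0 = -\<infinity>\<close>.\<close>

definition abg_order ::
  "(real \<Rightarrow> real) \<Rightarrow> (real \<Rightarrow> real) \<Rightarrow> (real \<Rightarrow> real) \<Rightarrow> (complex \<Rightarrow> complex) \<Rightarrow> ereal" where
  "abg_order \<alpha> \<beta> \<gamma> f =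
     Limsup at_top (\<lambda>r. ereal (\<alpha> (ln (nevanlinna_T r f)) / \<beta> (ln (\<gamma> r))))"

definition abg_log_order ::
  "(real \<Rightarrow> real) \<Rightarrow> (real \<Rightarrow> real) \<Rightarrow> (real \<Rightarrow> real) \<Rightarrow> (complex \<Rightarrow> complex) \<Rightarrow> ereal" where
  "abg_log_order \<alpha> \<beta> \<gamma> f =
     Limsup at_top (\<lambda>r. ereal (\<alpha> ((ln ^^ 2) (nevanlinna_T r f)) / \<beta> (ln (\<gamma> r))))"

end

(* Everything is reduced to maximum moduli: the scale functions do not see constant factors of
   log T, nor the replacement of r by a constant multiple of r, so T(r, g) and log M(r, g) are
   interchangeable.  For the upper bound, the sum of |f^(j)|^2 along a ray satisfies a Gronwall
   inequality, hence T(r, f) is at most exponential in a power of max_j M(r, A_j).  For the lower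
   bound, the equation gives |A_0| <= sum |A_j| |f^(j) / f|.  Instead of using the lemma on the
   logarithmic derivative, choose a circle that keeps away from the zeros of f; on it |f^(j) / f|
   is pointwise at most a power of T(100 r, f), so that no exceptional set of radii arises. *)

theory Submission
  imports Defs
begin

section \<open>Characteristic and maximum modulus of entire functions\<close>

text \<open>Both inequalities between the orders come from one shape of estimate, U(r) \<le> C (1 +
  log r + sum of max 1 (V_i(c r))), which bounds the order of U by the largest order of the V_i. For
  the upper bound U = log T(r, f) and V_j = T(r, A_j); for the lower bound U = T(r, A_0), V_j = T(r,
  A_j) for j \<ge> 1, and V_0 = log T(r, f). The delicate point is what the division by f costs. The
  number of zeros in a disc is at most a multiple of log M, so some circle keeps a distance from all
  of them that is only polynomially small in log M. The loss in |f^(j) / f| is then a power of log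
  M, and its logarithm is of the size of log T(r, f), exactly the quantity measured by the order of
  f. The disc is centred at a point where f does not vanish, because f may vanish at the origin; the
  maximum principle carries the bound on A_0 from the circle back to |z| = r. The lower bound first
  gives the order of A_0 at most the maximum of the order of f and those of A_1, ..., A_(k-1). The
  strict dominance of A_0 rules the latter out.\<close>

lemma max_0_ln:
  fixes x :: real
  assumes "0 \<le> x"
  shows "max 0 (ln x) = ln (max 1 x)"
  using assms ln_ge_zero[of x] ln_le_zero_iff[of x] by (cases "x = 0") (auto simp: max_def)

text \<open>Written as \<open>ln (max 1 ...)\<close>, the function is visibly continuous at the
  zeros of \<open>f\<close> too, where \<open>ln (norm (f x))\<close> alone is not.\<close>

lemma continuous_on_max_0_ln_norm:
  fixes f :: "'a::topological_space \<Rightarrow> complex"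
  assumes "continuous_on S f"
  shows "continuous_on S (\<lambda>x. max 0 (ln (norm (f x))))"
proof -
  have "continuous_on S (\<lambda>x. ln (max 1 (norm (f x))))"
    using assms by (intro continuous_intros) auto
  then show ?thesis by (simp add: max_0_ln)
qed

lemma nevanlinna_T_entire:
  assumes "f holomorphic_on UNIV"
  shows "nevanlinna_T r f = nevanlinna_m r f"
proof -
  have "\<not> is_pole f z" for z
    using assms not_is_pole_holomorphic by blast
  then have "nevanlinna_n t f = 0" for t
    by (simp add: nevanlinna_n_def)
  then show ?thesis
    by (simp add: nevanlinna_T_def nevanlinna_N_def)
qed

lemma integrable_nevanlinna_m:
  fixes f :: "complex \<Rightarrow> complex"
  assumes "continuous_on UNIV f"
  shows "(\<lambda>t. max 0 (ln (norm (f (of_real r * cis t))))) integrable_on {0..2 * pi}"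
proof (rule integrable_continuous_interval, rule continuous_on_max_0_ln_norm)
  show "continuous_on {0..2 * pi} (\<lambda>t. f (of_real r * cis t))"
    by (intro continuous_on_compose2[OF assms] continuous_intros) auto
qed

lemma nevanlinna_T_nonneg:
  assumes "f holomorphic_on UNIV"
  shows "0 \<le> nevanlinna_T r f"
  unfolding nevanlinna_T_entire[OF assms] nevanlinna_m_def
  using integrable_nevanlinna_m[of f r] assms
  by (intro mult_nonneg_nonneg integral_nonneg) (auto simp: holomorphic_on_imp_continuous_on)

lemma nevanlinna_T_le:
  assumes "f holomorphic_on UNIV" "0 \<le> r" "0 \<le> X"
    and bound: "\<And>z. norm z = r \<Longrightarrow> norm (f z) \<le> exp X"
  shows "nevanlinna_T r f \<le> X"
proof -
  have "integral {0..2 * pi} (\<lambda>t. max 0 (ln (norm (f (of_real r * cis t))))) \<le>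
        integral {0..2 * pi} (\<lambda>t. X)"
  proof (intro integral_le integrable_nevanlinna_m)
    fix t
    have "norm (f (of_real r * cis t)) \<le> exp X"
      using assms(2) by (intro bound) (simp add: norm_mult)
    \<comment> \<open>Monotonicity of \<open>ln\<close> needs a positive argument; at a zero of
      \<open>f\<close> the default value \<open>ln 0 = 0\<close> is covered by
      \<open>0 \<le> X\<close>.\<close>
    then have "ln (norm (f (of_real r * cis t))) \<le> X"
      using assms(3) ln_mono[of "norm (f (of_real r * cis t))" "exp X"]
      by (cases "f (of_real r * cis t) = 0") auto
    then show "max 0 (ln (norm (f (of_real r * cis t)))) \<le> X"
      using assms(3) by simp
  qed (use assms(1) in \<open>auto simp: holomorphic_on_imp_continuous_on\<close>)
  then show ?thesis
    by (simp add: nevanlinna_T_entire[OF assms(1)] nevanlinna_m_def field_simps)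
qed

text \<open>On the unit circle these are exactly the real trigonometric polynomials.\<close>

definition circle_trig :: "(complex \<Rightarrow> real) set" where
  "circle_trig = {p. \<exists>q. \<forall>z. norm z = 1 \<longrightarrow> p z = Re (poly q z)}"

lemma circle_trig_add:
  assumes "p \<in> circle_trig" "p' \<in> circle_trig"
  shows "(\<lambda>z. p z + p' z) \<in> circle_trig"
proof -
  obtain a b where "\<And>z. norm z = 1 \<Longrightarrow> p z = Re (poly a z)"
    "\<And>z. norm z = 1 \<Longrightarrow> p' z = Re (poly b z)"
    using assms unfolding circle_trig_def by blast
  then have "p z + p' z = Re (poly (a + b) z)" if "norm z = 1" for z
    using that by simp
  then show ?thesis unfolding circle_trig_def by blast
qed

lemma circle_trig_Re_poly: "(\<lambda>z. Re (poly q z)) \<in> circle_trig"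
  unfolding circle_trig_def by auto

lemma circle_trig_sum:
  assumes "\<And>i. i \<in> I \<Longrightarrow> p i \<in> circle_trig"
  shows "(\<lambda>z. \<Sum>i\<in>I. p i z) \<in> circle_trig"
  using assms
proof (induction I rule: infinite_finite_induct)
  case (insert x F)
  then show ?case using circle_trig_add[of "p x" "\<lambda>z. \<Sum>i\<in>F. p i z"] by simp
qed (use circle_trig_Re_poly[of 0] in auto)

text \<open>On the unit circle \<open>cnj z\<close> is \<open>1 / z\<close>, so cancelling the
  smaller power leaves a monomial or the conjugate of one, and conjugation keeps the real
  part.\<close>

lemma circle_trig_cnj_monom: "(\<lambda>z. Re (a * z ^ i * cnj (b * z ^ j))) \<in> circle_trig"
proof -
  have zz: "z ^ n * cnj z ^ n = 1" if "norm z = 1" for z :: complex and n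
    using complex_norm_square[of z] that by (simp flip: power_mult_distrib)
  consider "j \<le> i" | "i \<le> j" by linarith
  then show ?thesis
  proof cases
    case 1
    have "Re (a * z ^ i * cnj (b * z ^ j)) = Re (poly (monom (a * cnj b) (i - j)) z)"
      if "norm z = 1" for z
    proof -
      have "z ^ i = z ^ (i - j) * z ^ j" using 1 by (simp flip: power_add)
      then have "a * z ^ i * cnj (b * z ^ j) = (a * cnj b) * z ^ (i - j) * (z ^ j * cnj z ^ j)"
        by (simp add: mult_ac)
      also have "\<dots> = poly (monom (a * cnj b) (i - j)) z"
        by (simp only: zz[OF that] mult_1_right poly_monom)
      finally show ?thesis by (rule arg_cong)
    qed
    then show ?thesis unfolding circle_trig_def by blast
  next
    case 2
    have "Re (a * z ^ i * cnj (b * z ^ j)) = Re (poly (monom (cnj a * b) (j - i)) z)"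
      if "norm z = 1" for z
    proof -
      have "z ^ j = z ^ (j - i) * z ^ i" using 2 by (simp flip: power_add)
      then have "cnj (a * z ^ i * cnj (b * z ^ j)) = (cnj a * b) * z ^ (j - i) * (z ^ i * cnj z ^ i)"
        by (simp add: mult_ac)
      also have "\<dots> = poly (monom (cnj a * b) (j - i)) z"
        by (simp only: zz[OF that] mult_1_right poly_monom)
      finally show ?thesis by (metis cnj.simps(1))
    qed
    then show ?thesis unfolding circle_trig_def by blast
  qed
qed

text \<open>By 2 Re a Re b = Re (a b) + Re (a cnj b) the product splits into the real part of a
  polynomial and the mixed monomials treated before.\<close>

lemma circle_trig_mult:
  assumes "p \<in> circle_trig" "p' \<in> circle_trig"
  shows "(\<lambda>z. p z * p' z) \<in> circle_trig"
proof -
  obtain a b where ab: "\<And>z. norm z = 1 \<Longrightarrow> p z = Re (poly a z)"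
    "\<And>z. norm z = 1 \<Longrightarrow> p' z = Re (poly b z)"
    using assms unfolding circle_trig_def by blast
  have half: "(\<lambda>z. Re (poly a z * cnj (poly (smult (1/2) b) z))) \<in> circle_trig"
  proof -
    have "(\<lambda>z. \<Sum>i\<le>degree a. \<Sum>j\<le>degree (smult (1/2) b).
            Re (coeff a i * z ^ i * cnj (coeff (smult (1/2) b) j * z ^ j))) \<in> circle_trig"
      by (intro circle_trig_sum circle_trig_cnj_monom)
    then show ?thesis
      by (simp only: poly_altdef cnj_sum sum_product Re_sum)
  qed
  have "(\<lambda>z. Re (poly (smult (1/2) (a * b)) z) + Re (poly a z * cnj (poly (smult (1/2) b) z)))
      \<in> circle_trig"
    by (intro circle_trig_add circle_trig_Re_poly half)
  then obtain q where q: "\<And>z. norm z = 1 \<Longrightarrow>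
      Re (poly (smult (1/2) (a * b)) z) + Re (poly a z * cnj (poly (smult (1/2) b) z)) = Re (poly q z)"
    unfolding circle_trig_def by blast
  have "p z * p' z = Re (poly q z)" if "norm z = 1" for z
    using q[OF that] ab[OF that] by (simp add: field_simps)
  then show ?thesis unfolding circle_trig_def by blast
qed

text \<open>Stone-Weierstrass supplies polynomials in the two real coordinates. On the circle they
  become real parts of holomorphic polynomials, to which the maximum principle applies inside the
  disc.\<close>

lemma real_polynomial_function_circle_trig:
  fixes p :: "complex \<Rightarrow> real"
  assumes "real_polynomial_function p"
  shows "p \<in> circle_trig"
  using assms
proof (induction rule: real_polynomial_function.induct)
  case (linear h)
  interpret bounded_linear h by fact
  have "h z = Re (poly [:0, Complex (h 1) (- h \<i>):] z)" for z
  proof -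
    have "z = Re z *\<^sub>R 1 + Im z *\<^sub>R \<i>" by (simp add: complex_eq_iff)
    then have "h z = h (Re z *\<^sub>R 1 + Im z *\<^sub>R \<i>)" by simp
    also have "\<dots> = Re z * h 1 + Im z * h \<i>" by (simp only: add scaleR real_scaleR_def)
    finally show ?thesis by simp
  qed
  then show ?case unfolding circle_trig_def by blast
next
  case (const c)
  show ?case using circle_trig_Re_poly[of "[:of_real c:]"] by simp
qed (auto intro: circle_trig_add circle_trig_mult)

text \<open>Harnack's inequality, from the Schwarz lemma for the Cayley transform of \<open>q\<close>.\<close>

lemma norm_le_of_Re_pos:
  assumes hol: "q holomorphic_on ball 0 1" and pos: "\<And>z. norm z < 1 \<Longrightarrow> 0 < Re (q z)"
    and real: "Im (q 0) = 0" and z: "norm z \<le> 1/2"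
  shows "norm (q z) \<le> 3 * Re (q 0)"
proof -
  define a where "a = Re (q 0)"
  have a: "0 < a" "q 0 = of_real a"
    using pos[of 0] real by (auto simp: a_def complex_eq_iff)
  define s where "s = (\<lambda>z. (q z - of_real a) / (q z + of_real a))"
  have nz: "q z + of_real a \<noteq> 0" if "norm z < 1" for z
    using pos[OF that] a by (auto simp: complex_eq_iff)
  have shol: "s holomorphic_on ball 0 1"
    unfolding s_def using nz by (intro holomorphic_intros hol) auto
  have slt: "norm (s z) < 1" if "norm z < 1" for z
  proof -
    \<comment> \<open>The difference of the two squares is 4 a Re q, which is positive.\<close>
    have "(norm (q z - of_real a))\<^sup>2 < (norm (q z + of_real a))\<^sup>2"
      using mult_pos_pos[OF pos[OF that] a(1)]
      unfolding cmod_power2 by (simp add: power2_eq_square algebra_simps)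
    then have "norm (q z - of_real a) < norm (q z + of_real a)"
      by (rule power2_less_imp_less) simp
    then show ?thesis using nz[OF that] by (simp add: s_def norm_divide)
  qed
  have "norm (s z) \<le> norm z"
    using z by (intro Schwarz_Lemma(1)[OF shol _ slt]) (auto simp: s_def a)
  then have "norm (q z - of_real a) \<le> norm z * norm (q z + of_real a)"
    using z nz[of z] by (simp add: s_def norm_divide divide_le_eq)
  also have "\<dots> \<le> 1/2 * norm (q z + of_real a)"
    using z by (intro mult_right_mono) auto
  finally have "norm (q z - of_real a) \<le> 1/2 * norm (q z + of_real a)" .
  \<comment> \<open>Together, |q| - a \<le> (|q| + a) / 2, which is the bound by 3 a.\<close>
  moreover have "norm (q z) - a \<le> norm (q z - of_real a)"
    using norm_triangle_ineq2[of "q z" "of_real a"] a by simp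
  moreover have "norm (q z + of_real a) \<le> norm (q z) + a"
    using norm_triangle_ineq[of "q z" "of_real a"] a by simp
  ultimately show ?thesis by (simp add: a_def)
qed

text \<open>Cauchy's formula at the centre: on the unit circle the derivative of the path cancels
  the denominator up to the factor \<open>\<i>\<close>.\<close>

lemma poly_mean_value: "((\<lambda>t. poly q (cis t)) has_integral 2 * pi * poly q 0) {0..2 * pi}"
proof -
  have "((\<lambda>u. poly q u / (u - 0)) has_contour_integral (2 * of_real pi * \<i> * poly q 0))
      (circlepath 0 1)"
    by (rule Cauchy_integral_circlepath_simple) (auto intro!: holomorphic_intros)
  then have "((\<lambda>t. poly q (cis t) * \<i>) has_integral (2 * of_real pi * \<i> * poly q 0)) {0..2 * pi}"
    by (simp add: circlepath_def has_contour_integral_part_circlepath_iff)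
  from has_integral_mult_right[OF this, of "- \<i>"] show ?thesis
    by (simp add: mult_ac)
qed

lemma norm_mult_exp_uminus_le_1:
  fixes a b :: complex
  shows "norm (a * exp (- b)) \<le> 1 \<longleftrightarrow> norm a \<le> exp (Re b)"
proof -
  have "norm (a * exp (- b)) = norm a * exp (- Re b)" by (simp add: norm_mult)
  also have "\<dots> = norm a / exp (Re b)" by (simp add: exp_minus divide_inverse)
  finally show ?thesis by (simp add: divide_le_eq)
qed

text \<open>In place of the Poisson integral: on the circle, \<open>log\<^sup>+ |f|\<close> is approximated from above by
  \<open>Re q\<close> for a polynomial \<open>q\<close>.  Then \<open>|f exp (-q)| \<le> 1\<close> inside, so \<open>log |f| \<le> Re q\<close>, and Harnack
  compares \<open>Re q\<close> with its value at the centre, which is its mean over the circle.\<close>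

lemma norm_le_exp_nevanlinna_T:
  assumes hol: "f holomorphic_on UNIV" and r: "0 < r" and z: "norm z \<le> r"
  shows "norm (f z) \<le> exp (3 * nevanlinna_T (2 * r) f)"
proof -
  define u where "u = (\<lambda>w. max 0 (ln (norm (f (of_real (2 * r) * w)))))"
  define m where "m = nevanlinna_T (2 * r) f"
  have cont: "continuous_on A f" for A
    using hol holomorphic_on_imp_continuous_on continuous_on_subset by blast
  have contu: "continuous_on A u" for A
    unfolding u_def
    by (intro continuous_on_max_0_ln_norm continuous_on_compose2[OF cont[of UNIV]] continuous_intros) auto
  have u_int: "(\<lambda>t. u (cis t)) integrable_on {0..2 * pi}"
    unfolding u_def by (rule integrable_nevanlinna_m[OF cont])
  have m_eq: "integral {0..2 * pi} (\<lambda>t. u (cis t)) = 2 * pi * m"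
    by (simp add: m_def nevanlinna_T_entire[OF hol] nevanlinna_m_def u_def)
  have step: "norm (f z) \<le> exp (3 * (m + 3 * e))" if e: "0 < e" for e
  proof -
    \<comment> \<open>Approximating \<open>u + 2 * e\<close> to within \<open>e\<close> places the
      polynomial strictly between \<open>u + e\<close> and \<open>u + 3 * e\<close>; the lower
      margin will make its real part positive.\<close>
    have "continuous_on (sphere 0 1) (\<lambda>w. u w + 2 * e)"
      by (intro continuous_on_add continuous_on_const contu)
    from Stone_Weierstrass_real_polynomial_function[OF compact_sphere this e]
    obtain p where p: "real_polynomial_function p"
      "\<And>w. w \<in> sphere 0 1 \<Longrightarrow> \<bar>(u w + 2 * e) - p w\<bar> < e" by blast
    from real_polynomial_function_circle_trig[OF p(1)]
    obtain q0 where q0: "\<And>w. norm w = 1 \<Longrightarrow> p w = Re (poly q0 w)"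
      unfolding circle_trig_def by blast
    \<comment> \<open>Removing an imaginary constant leaves the real part alone and makes the value
      at the centre real, as Harnack's inequality requires.\<close>
    define q where "q = q0 - [:\<i> * of_real (Im (poly q0 0)):]"
    have q: "u w + e < Re (poly q w)" "Re (poly q w) < u w + 3 * e" if "norm w = 1" for w
      using p(2)[of w] q0[OF that] that by (auto simp: q_def)
    have Im_q: "Im (poly q 0) = 0" by (simp add: q_def)
    \<comment> \<open>The minimum principle for \<open>Re q\<close>, read as the maximum principle
      for \<open>exp (- q)\<close>.\<close>
    have "norm (exp (- poly q w)) \<le> exp (- e)" if "norm w \<le> 1" for w
    proof (rule maximum_modulus_frontier[of "\<lambda>w. exp (- poly q w)" "cball 0 1"])
      fix w :: complex assume "w \<in> frontier (cball 0 1)"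
      then have "norm w = 1" by simp
      from q(1)[OF this] have "e < Re (poly q w)"
        by (smt (verit) u_def max.cobounded1)
      then show "norm (exp (- poly q w)) \<le> exp (- e)" by simp
    qed (use that in \<open>auto intro!: holomorphic_intros continuous_intros\<close>)
    then have pos: "0 < Re (poly q w)" if "norm w < 1" for w
    proof -
      have "norm (exp (- poly q w)) \<le> exp (- e)"
        using \<open>\<And>w. norm w \<le> 1 \<Longrightarrow> norm (exp (- poly q w)) \<le> exp (- e)\<close> that by simp
      then show ?thesis using e by simp
    qed
    have Hhol: "(\<lambda>w. f (of_real (2 * r) * w) * exp (- poly q w)) holomorphic_on S" for S
    proof -
      have "(f \<circ> (\<lambda>w. of_real (2 * r) * w)) holomorphic_on S"
        by (rule holomorphic_on_compose_gen[OF _ hol]) (auto intro!: holomorphic_intros)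
      then have "(\<lambda>w. f (of_real (2 * r) * w)) holomorphic_on S" by (simp add: o_def)
      moreover have "(\<lambda>w. exp (- poly q w)) holomorphic_on S" by (intro holomorphic_intros)
      ultimately show ?thesis by (rule holomorphic_on_mult)
    qed
    have "norm (f (of_real (2 * r) * w) * exp (- poly q w)) \<le> 1" if "norm w \<le> 1" for w
    proof (rule maximum_modulus_frontier[of "\<lambda>w. f (of_real (2 * r) * w) * exp (- poly q w)" "cball 0 1"])
      fix w :: complex assume "w \<in> frontier (cball 0 1)"
      then have w: "norm w = 1" by simp
      let ?a = "f (of_real (2 * r) * w)"
      have "norm ?a \<le> exp (u w)"
        unfolding u_def by (cases "?a = 0") (auto simp: max_def)
      also have "\<dots> \<le> exp (Re (poly q w))"
        using q(1)[OF w] e by simp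
      finally show "norm (?a * exp (- poly q w)) \<le> 1"
        by (simp only: norm_mult_exp_uminus_le_1)
    qed (use that in \<open>auto intro: Hhol holomorphic_on_imp_continuous_on simp del: of_real_mult\<close>)
    from this[of "z / of_real (2 * r)"] have "norm (f z * exp (- poly q (z / of_real (2 * r)))) \<le> 1"
      using z r by (simp add: norm_divide norm_mult)
    then have "norm (f z) \<le> exp (Re (poly q (z / of_real (2 * r))))"
      by (simp only: norm_mult_exp_uminus_le_1)
    moreover have "norm (poly q (z / of_real (2 * r))) \<le> 3 * Re (poly q 0)"
    proof (rule norm_le_of_Re_pos)
      show "norm (z / of_real (2 * r)) \<le> 1 / 2"
        using z r by (simp add: norm_divide norm_mult)
    qed (auto intro: pos Im_q holomorphic_intros)
    then have "Re (poly q (z / of_real (2 * r))) \<le> 3 * Re (poly q 0)"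
      using complex_Re_le_cmod order_trans by blast
    moreover have "Re (poly q 0) \<le> m + 3 * e"
    proof -
      have 1: "((\<lambda>t. Re (poly q (cis t))) has_integral 2 * pi * Re (poly q 0)) {0..2 * pi}"
        using has_integral_Re[OF poly_mean_value[of q]] by simp
      have 2: "((\<lambda>t. u (cis t) + 3 * e) has_integral 2 * pi * m + 2 * pi * (3 * e)) {0..2 * pi}"
        using has_integral_add[OF integrable_integral[OF u_int] has_integral_const_real[of "3 * e" 0 "2 * pi"]]
        unfolding m_eq by simp
      have "2 * pi * Re (poly q 0) \<le> 2 * pi * m + 2 * pi * (3 * e)"
        using q(2)[of "cis _"] by (intro has_integral_le[OF 1 2]) (auto intro: less_imp_le)
      then have "2 * pi * Re (poly q 0) \<le> 2 * pi * (m + 3 * e)" by (simp add: algebra_simps)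
      then show ?thesis by (subst (asm) mult_le_cancel_left_pos) auto
    qed
    ultimately show ?thesis
      by (smt (verit) exp_le_cancel_iff)
  qed
  have "((\<lambda>e. exp (3 * (m + 3 * e))) \<longlongrightarrow> exp (3 * (m + 3 * 0))) (at_right 0)"
    by (intro tendsto_intros)
  moreover have "eventually (\<lambda>e. norm (f z) \<le> exp (3 * (m + 3 * e))) (at_right 0)"
    using eventually_at_right_less[of 0] by (rule eventually_mono) (use step in simp)
  ultimately have "norm (f z) \<le> exp (3 * (m + 3 * 0))"
    by (intro tendsto_lowerbound[of _ _ "at_right 0"]) auto
  then show ?thesis by (simp add: m_def)
qed

section \<open>Derivatives of an entire function on a circle away from its zeros\<close>

lemma norm_prod_list_ge:
  fixes as :: "complex list"
  assumes "\<And>a. a \<in> set as \<Longrightarrow> d \<le> norm (z - a)" "0 \<le> d"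
  shows "d ^ length as \<le> norm (\<Prod>a\<leftarrow>as. z - a)"
  using assms by (induction as) (auto simp: norm_mult intro!: mult_mono)

lemma norm_prod_list_le:
  fixes as :: "complex list"
  assumes "\<And>a. a \<in> set as \<Longrightarrow> norm (w - a) \<le> q * norm (z - a)" "0 \<le> q"
  shows "norm (\<Prod>a\<leftarrow>as. w - a) \<le> q ^ length as * norm (\<Prod>a\<leftarrow>as. z - a)"
  using assms
proof (induction as)
  case (Cons a as)
  have "norm (w - a) * norm (\<Prod>a\<leftarrow>as. w - a) \<le>
      (q * norm (z - a)) * (q ^ length as * norm (\<Prod>a\<leftarrow>as. z - a))"
    using Cons by (intro mult_mono) auto
  then show ?case by (simp add: norm_mult mult_ac)
qed simp

text \<open>This does the work of Jensen's formula. On the circle of radius \<open>3 * R\<close>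
  each linear factor has modulus at least \<open>2 * R\<close>, at the centre at most
  \<open>R\<close>, so every zero gains a factor 2. Taking \<open>z = c\<close> counts the zeros;
  other \<open>z\<close> compare \<open>F\<close> with its value at the centre.\<close>

lemma zeros_quotient_bound:
  assumes F: "F holomorphic_on UNIV" and eq: "\<And>z. f z = F z * (\<Prod>a\<leftarrow>as. z - a)"
    and as: "set as \<subseteq> cball c R" and R: "0 < R"
    and M: "\<And>z. z \<in> cball c (3 * R) \<Longrightarrow> norm (f z) \<le> M"
    and z: "z \<in> cball c (3 * R)"
  shows "norm (F z) * norm (f c) * 2 ^ length as \<le> M * norm (F c)"
proof -
  have "norm (F z) \<le> M / (2 * R) ^ length as"
  proof (rule maximum_modulus_frontier[of F "cball c (3 * R)"])
    fix z assume "z \<in> frontier (cball c (3 * R))"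
    then have z: "norm (z - c) = 3 * R" "z \<in> cball c (3 * R)"
      using R by (auto simp: dist_norm norm_minus_commute)
    have "(2 * R) ^ length as \<le> norm (\<Prod>a\<leftarrow>as. z - a)"
    proof (rule norm_prod_list_ge)
      fix a assume "a \<in> set as"
      then have "norm (a - c) \<le> R" using as by (auto simp: dist_norm norm_minus_commute)
      then show "2 * R \<le> norm (z - a)" using z norm_triangle_ineq2[of "z - c" "a - c"] by simp
    qed (use R in simp)
    then have "norm (F z) * (2 * R) ^ length as \<le> norm (F z) * norm (\<Prod>a\<leftarrow>as. z - a)"
      by (intro mult_left_mono) auto
    also have "\<dots> \<le> M" using M[OF z(2)] by (simp add: eq norm_mult)
    finally show "norm (F z) \<le> M / (2 * R) ^ length as"
      using R by (simp add: field_simps)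
  qed (use F z in \<open>auto intro: holomorphic_on_subset holomorphic_on_imp_continuous_on
        continuous_on_subset\<close>)
  moreover have "norm (f c) \<le> norm (F c) * R ^ length as"
  proof -
    have "norm (\<Prod>a\<leftarrow>as. c - a) \<le> R ^ length as"
      using as R by (induction as) (auto simp: norm_mult dist_norm intro!: mult_mono)
    then show ?thesis by (simp add: eq norm_mult mult_left_mono)
  qed
  ultimately have "norm (F z) * norm (f c) \<le> M / (2 * R) ^ length as * (norm (F c) * R ^ length as)"
    by (rule mult_mono) (use order_trans[OF norm_ge_zero M[of c]] R in auto)
  also have "\<dots> * 2 ^ length as = M * norm (F c)"
    using R by (simp add: power_mult_distrib)
  finally show ?thesis by simp
qed

lemma entire_factor_zeros:
  assumes hol: "f holomorphic_on UNIV" and fc: "f c \<noteq> 0" and R: "0 < R"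
    and M: "\<And>z. z \<in> cball c (3 * R) \<Longrightarrow> norm (f z) \<le> M"
  obtains F as where "F holomorphic_on UNIV" "\<And>z. f z = F z * (\<Prod>a\<leftarrow>as. z - a)"
    "\<And>z. z \<in> cball c R \<Longrightarrow> F z \<noteq> 0" "norm (f c) * 2 ^ length as \<le> M"
    "\<And>z. z \<in> cball c R \<Longrightarrow> norm (F z) * norm (f c) \<le> M * norm (F c)"
proof -
  \<comment> \<open>Since \<open>len\<close> bounds the number of linear factors, a longest such list leaves no zero in the disc.\<close>
  define P where "P = (\<lambda>as. set as \<subseteq> cball c R \<and>
    (\<exists>F. F holomorphic_on UNIV \<and> (\<forall>z. f z = F z * (\<Prod>a\<leftarrow>as. z - a))))"
  have len: "norm (f c) * 2 ^ length as \<le> M" if P: "P as" for as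
  proof -
    obtain F where F: "set as \<subseteq> cball c R" "F holomorphic_on UNIV"
      "\<And>z. f z = F z * (\<Prod>a\<leftarrow>as. z - a)"
      using P unfolding P_def by blast
    from zeros_quotient_bound[OF F(2,3,1) R M, of c]
    have "norm (F c) * (norm (f c) * 2 ^ length as) \<le> norm (F c) * M" using R by (simp add: mult_ac)
    moreover have "F c \<noteq> 0" using fc F(3)[of c] by auto
    ultimately show ?thesis by (subst (asm) mult_le_cancel_left_pos) auto
  qed
  have "P []" using hol by (auto simp: P_def)
  moreover have "\<forall>as. P as \<longrightarrow> length as \<le> nat \<lceil>M / norm (f c)\<rceil>"
  proof (intro allI impI)
    fix as assume "P as"
    from len[OF this] have "2 ^ length as \<le> M / norm (f c)" using fc by (simp add: field_simps)
    moreover have "real (length as) \<le> 2 ^ length as" by (rule of_nat_less_two_power[THEN less_imp_le])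
    ultimately show "length as \<le> nat \<lceil>M / norm (f c)\<rceil>" by linarith
  qed
  ultimately obtain as where as: "P as" "\<And>bs. P bs \<Longrightarrow> length bs \<le> length as"
    using ex_has_greatest_nat[of P "[]" length "Suc (nat \<lceil>M / norm (f c)\<rceil>)"]
    by (auto simp: less_Suc_eq_le)
  then obtain F where F: "set as \<subseteq> cball c R" "F holomorphic_on UNIV"
    "\<And>z. f z = F z * (\<Prod>a\<leftarrow>as. z - a)"
    unfolding P_def by blast
  show thesis
  proof (rule that[OF F(2,3)])
    show "norm (f c) * 2 ^ length as \<le> M" by (rule len[OF as(1)])
    fix z assume z: "z \<in> cball c R"
    show "F z \<noteq> 0"
    proof
      assume Fz: "F z = 0"
      \<comment> \<open>The difference quotient of \<open>F\<close> at its zero is again entire, so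
        one more linear factor could be split off, against maximality.\<close>
      define G where "G = (\<lambda>w. if w = z then deriv F z else (F w - F z) / (w - z))"
      have "G holomorphic_on UNIV" unfolding G_def using F(2) by (intro pole_lemma_open) auto
      moreover have "f w = G w * (\<Prod>a\<leftarrow>z # as. w - a)" for w
        using F(3)[of w] Fz by (simp add: G_def)
      ultimately have "P (z # as)" using z F(1) by (auto simp: P_def)
      from as(2)[OF this] show False by simp
    qed
    have "norm (F z) * norm (f c) * 1 \<le> norm (F z) * norm (f c) * 2 ^ length as"
      by (intro mult_left_mono) auto
    also have "\<dots> \<le> M * norm (F c)"
      using z R by (intro zeros_quotient_bound[OF F(2,3,1) R M]) auto
    finally show "norm (F z) * norm (f c) \<le> M * norm (F c)" by simp
  qed
qed

text \<open>Pigeonhole: of n + 1 equal pieces of \<open>[r, 2 * r]\<close>, some piece contains none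
  of the n given points, and its midpoint is half a piece away from all of them.\<close>

lemma ex_radius_avoiding:
  fixes ts :: "real list"
  assumes r: "0 < r"
  obtains \<rho> where "r \<le> \<rho>" "\<rho> \<le> 2 * r"
    "\<And>t. t \<in> set ts \<Longrightarrow> r / (2 * (real (length ts) + 1)) \<le> \<bar>\<rho> - t\<bar>"
proof -
  define n where "n = length ts"
  \<comment> \<open>The index of the piece containing \<open>t\<close>. Points to the left of
    \<open>r\<close> get index 0 through \<open>nat\<close>, which at worst blocks a piece that is
    free.\<close>
  define g where "g = (\<lambda>t. nat \<lfloor>(t - r) * (real n + 1) / r\<rfloor>)"
  have "card (g ` set ts) < card {..n}"
    using card_image_le[of "set ts" g] card_length[of ts] by (simp add: n_def)
  then have "\<not> {..n} \<subseteq> g ` set ts"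
    using card_mono[of "g ` set ts" "{..n}"] by auto
  then obtain j where j: "j \<le> n" "j \<notin> g ` set ts" by auto
  define \<rho> where "\<rho> = r + (real j + 1/2) * r / (real n + 1)"
  show thesis
  proof (rule that)
    show "r \<le> \<rho>" using r by (simp add: \<rho>_def)
    have "(real j + 1/2) * r \<le> (real n + 1) * r" using j r by (intro mult_right_mono) auto
    then show "\<rho> \<le> 2 * r" using r by (simp add: \<rho>_def field_simps)
    fix t assume t: "t \<in> set ts"
    show "r / (2 * (real (length ts) + 1)) \<le> \<bar>\<rho> - t\<bar>"
    proof (rule ccontr)
      assume "\<not> ?thesis"
      then have "\<bar>\<rho> - t\<bar> * ((real n + 1) / r) < 1 / 2"
        using r by (simp add: n_def field_simps)
      moreover have "\<bar>\<rho> - t\<bar> * ((real n + 1) / r) = \<bar>(\<rho> - t) * ((real n + 1) / r)\<bar>"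
        using r by (simp add: abs_mult)
      moreover have "(\<rho> - t) * ((real n + 1) / r) = real j + 1/2 - (t - r) * (real n + 1) / r"
      proof -
        define N where "N = real n + 1"
        have "0 < N" by (simp add: N_def)
        then have "\<rho> * (N / r) = N + (real j + 1/2)"
          using r unfolding \<rho>_def N_def[symmetric] by (simp add: field_simps)
        moreover have "(t - r) * N / r = t * (N / r) - N"
          using r by (simp add: left_diff_distrib diff_divide_distrib)
        ultimately show ?thesis unfolding N_def[symmetric] left_diff_distrib by linarith
      qed
      ultimately have "\<bar>real j + 1/2 - (t - r) * (real n + 1) / r\<bar> < 1 / 2" by metis
      then have "\<lfloor>(t - r) * (real n + 1) / r\<rfloor> = int j" by linarith
      then have "g t = j" by (simp add: g_def)
      with j t show False by blast
    qed
  qed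
qed

text \<open>\<open>B - g\<close> has positive real part, so Harnack on the disc of radius
  \<open>8 * r\<close> gives |g| \<le> 3 B + B on radius \<open>4 * r\<close>. Cauchy's estimate on
  discs of radius \<open>r\<close> then bounds the derivative on radius \<open>3 * r\<close>, which
  is convex.\<close>

lemma Borel_Caratheodory_increment:
  assumes g: "g holomorphic_on ball c (8 * r)" and g0: "g c = 0" and r: "0 < r"
    and Re: "\<And>z. z \<in> ball c (8 * r) \<Longrightarrow> Re (g z) < B"
    and zw: "z \<in> cball c (3 * r)" "w \<in> cball c (3 * r)"
  shows "norm (g w - g z) \<le> 4 * B / r * norm (w - z)"
proof -
  have B: "0 < B" using Re[of c] g0 r by simp
  have bound: "norm (g z) \<le> 4 * B" if z: "norm (z - c) \<le> 4 * r" for z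
  proof -
    define q where "q = (\<lambda>w. of_real B - g (c + of_real (8 * r) * w))"
    have mem: "c + of_real (8 * r) * w \<in> ball c (8 * r)" if "norm w < 1" for w
      using that r by (simp add: dist_norm norm_mult)
    have "(g \<circ> (\<lambda>w. c + of_real (8 * r) * w)) holomorphic_on ball 0 1"
      using mem by (intro holomorphic_on_compose_gen[OF _ g]) (auto intro!: holomorphic_intros)
    then have "q holomorphic_on ball 0 1"
      unfolding q_def o_def by (intro holomorphic_intros)
    then have "norm (q ((z - c) / of_real (8 * r))) \<le> 3 * Re (q 0)"
    proof (rule norm_le_of_Re_pos)
      show "0 < Re (q w)" if "norm w < 1" for w
        using Re[OF mem[OF that]] by (simp add: q_def)
      show "norm ((z - c) / of_real (8 * r)) \<le> 1 / 2"
        using z r by (simp add: norm_divide norm_mult)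
    qed (simp add: q_def g0)
    then have "norm (of_real B - g z) \<le> 3 * B"
      using r by (simp add: q_def g0)
    then show ?thesis
      using norm_triangle_ineq4[of "of_real B" "of_real B - g z"] B by simp
  qed
  have deriv: "(g has_field_derivative deriv g x) (at x within cball c (3 * r))"
    and dbound: "norm (deriv g x) \<le> 4 * B / r" if x: "x \<in> cball c (3 * r)" for x
  proof -
    have sub: "cball x r \<subseteq> cball c (4 * r)"
    proof
      fix y assume "y \<in> cball x r"
      then show "y \<in> cball c (4 * r)" using x dist_triangle[of c y x] by simp
    qed
    then have "cball x r \<subseteq> ball c (8 * r)" using r by auto
    then have hol: "g holomorphic_on cball x r" using g holomorphic_on_subset by blast
    have "norm ((deriv ^^ 1) g x) \<le> fact 1 * (4 * B) / r ^ 1"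
    proof (rule Cauchy_inequality)
      fix y assume "norm (x - y) = r"
      then have "y \<in> cball x r" by (simp add: dist_norm)
      then have "y \<in> cball c (4 * r)" using sub by blast
      then show "norm (g y) \<le> 4 * B" by (intro bound) (simp add: dist_norm norm_minus_commute)
    qed (use hol r in \<open>auto intro: holomorphic_on_subset holomorphic_on_imp_continuous_on\<close>)
    then show "norm (deriv g x) \<le> 4 * B / r" by simp
    show "(g has_field_derivative deriv g x) (at x within cball c (3 * r))"
      using x r by (intro DERIV_subset[OF holomorphic_derivI[OF g open_ball]]) auto
  qed
  show ?thesis
    using field_differentiable_bound[OF convex_cball deriv dbound zw(2,1)] by simp
qed

text \<open>Write \<open>f = F(c) exp(g) \<Prod>(z - a)\<close> over the zeros \<open>a\<close> in a disc.  If the circle stays away from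
  the zeros, \<open>|f|\<close> changes at most by the factor \<open>exp 2\<close> within distance \<open>h\<close> of it, where \<open>1 / h\<close> is
  polynomial in \<open>b\<close>, and Cauchy's estimate on discs of radius \<open>h\<close> applies.\<close>

lemma higher_deriv_quotient_bound:
  assumes hol: "f holomorphic_on UNIV" and fc: "f c \<noteq> 0" and r: "16 \<le> r" and b: "0 \<le> b"
    and M: "\<And>z. z \<in> cball c (24 * r) \<Longrightarrow> norm (f z) \<le> norm (f c) * exp b"
  obtains \<rho> where "r \<le> \<rho>" "\<rho> \<le> 2 * r" "\<And>z. z \<in> sphere c \<rho> \<Longrightarrow> f z \<noteq> 0"
    "\<And>z j. z \<in> sphere c \<rho> \<Longrightarrow>
      norm ((deriv ^^ j) f z) \<le> fact j * exp 2 * (b + 1) ^ (3 * j) * norm (f z)"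
proof -
  \<comment> \<open>The added 1 gives \<open>1 \<le> B\<close>, so that powers of \<open>B\<close>
    can be compared, and makes the bound on \<open>Re (g z)\<close> strict.\<close>
  define B where "B = b + 1"
  have r0: "0 < r" using r by simp
  have B: "1 \<le> B" using b by (simp add: B_def)
  have R8: "0 < 8 * r" using r by simp
  have M8: "norm (f z) \<le> norm (f c) * exp b" if "z \<in> cball c (3 * (8 * r))" for z
    using M that by simp
  obtain F as where F: "F holomorphic_on UNIV" "\<And>z. f z = F z * (\<Prod>a\<leftarrow>as. z - a)"
    "\<And>z. z \<in> cball c (8 * r) \<Longrightarrow> F z \<noteq> 0" "norm (f c) * 2 ^ length as \<le> norm (f c) * exp b"
    "\<And>z. z \<in> cball c (8 * r) \<Longrightarrow> norm (F z) * norm (f c) \<le> norm (f c) * exp b * norm (F c)"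
    using entire_factor_zeros[OF hol fc R8 M8] by blast
  define n where "n = length as"
  \<comment> \<open>From 2^n \<le> exp b and ln 2 \<ge> 1/2 follows n \<le> 2 b.\<close>
  have n: "real n + 1 \<le> 2 * B"
  proof -
    have "2 ^ n \<le> exp b" using F(4) fc by (simp add: n_def)
    then have "ln (2 ^ n) \<le> b" using ln_mono[of "2 ^ n" "exp b"] by simp
    then have "real n * ln 2 \<le> b" by (simp add: ln_realpow)
    moreover have "real n * (1/2) \<le> real n * ln 2"
      using ln2_ge_two_thirds by (intro mult_left_mono) auto
    ultimately show ?thesis by (simp add: B_def)
  qed
  obtain G where G: "G holomorphic_on ball c (8 * r)" "\<And>z. z \<in> ball c (8 * r) \<Longrightarrow> exp (G z) = F z"
  proof (rule holomorphic_logarithm_exists)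
    show "F holomorphic_on ball c (8 * r)" using F(1) holomorphic_on_subset by blast
    show "c \<in> ball c (8 * r)" using r by simp
  qed (use F(3) in auto)
  define g where "g = (\<lambda>z. G z - G c)"
  have g: "g holomorphic_on ball c (8 * r)" unfolding g_def by (intro holomorphic_intros G)
  have Fc: "F c \<noteq> 0" using F(3) r by simp
  have Fg: "F z = F c * exp (g z)" if "z \<in> ball c (8 * r)" for z
    using G(2)[OF that] G(2)[of c] r Fc by (simp add: g_def exp_diff)
  have Re_g: "Re (g z) < B" if z: "z \<in> ball c (8 * r)" for z
  proof -
    have "norm (F z) \<le> exp b * norm (F c)"
      using F(5)[of z] z fc by (simp add: mult_ac)
    then have "exp (Re (g z)) \<le> exp b" using Fc Fg[OF z] by (simp add: norm_mult mult_ac)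
    then show ?thesis by (simp add: B_def)
  qed
  define \<delta> where "\<delta> = r / (2 * (real n + 1))"
  \<comment> \<open>Small enough that, within distance \<open>h\<close>, both \<open>g\<close> and
    the logarithm of the product of linear factors grow by at most 1: \<open>4 * B / r * h\<close>
    and \<open>n * h / \<delta>\<close> are at most 1. As \<open>16 \<le> r\<close>, still
    \<open>1 / h \<le> B ^ 3\<close>.\<close>
  define h where "h = r / (16 * B ^ 3)"
  have \<delta>: "0 < \<delta>" using r by (simp add: \<delta>_def)
  have h: "0 < h" using r B by (simp add: h_def)
  have hr: "h \<le> r"
  proof -
    have "1 \<le> 16 * B ^ 3" using one_le_power[OF B, of 3] by linarith
    then show ?thesis using r B by (simp add: h_def divide_le_eq)
  qed
  have hB: "4 * B / r * h \<le> 1"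
    using r B one_le_power[OF B, of 2] by (simp add: h_def field_simps power_numeral_reduce)
  have h\<delta>: "real n * (h / \<delta>) \<le> 1"
  proof -
    have "real n * (h / \<delta>) = 2 * (real n * (real n + 1)) / (16 * B ^ 3)"
      using r B by (simp add: h_def \<delta>_def field_simps)
    also have "\<dots> \<le> 2 * ((2 * B) * (2 * B)) / (16 * B ^ 3)"
      using n B by (intro divide_right_mono mult_left_mono mult_mono) auto
    also have "\<dots> \<le> 1" using B by (simp add: field_simps power_numeral_reduce)
    finally show ?thesis .
  qed
  obtain \<rho> where \<rho>: "r \<le> \<rho>" "\<rho> \<le> 2 * r"
    "\<And>t. t \<in> set (map (\<lambda>a. norm (a - c)) as) \<Longrightarrow> \<delta> \<le> \<bar>\<rho> - t\<bar>"
    using ex_radius_avoiding[OF r0, of "map (\<lambda>a. norm (a - c)) as"] by (auto simp: \<delta>_def n_def)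
  show thesis
  proof (rule that[OF \<rho>(1,2)])
    fix z assume "z \<in> sphere c \<rho>"
    then have z: "norm (z - c) = \<rho>" by (simp add: dist_norm norm_minus_commute)
    have za: "\<delta> \<le> norm (z - a)" if "a \<in> set as" for a
      using \<rho>(3)[of "norm (a - c)"] that norm_triangle_ineq3[of "z - c" "a - c"] z by simp
    have "(\<Prod>a\<leftarrow>as. z - a) \<noteq> 0"
    proof -
      have "0 < \<delta> ^ length as" using \<delta> by simp
      also have "\<dots> \<le> norm (\<Prod>a\<leftarrow>as. z - a)" using \<delta> by (intro norm_prod_list_ge za) auto
      finally show ?thesis by simp
    qed
    then show "f z \<noteq> 0" using F(2)[of z] F(3)[of z] z \<rho> r by (simp add: dist_norm norm_minus_commute)
    fix j
    have close: "norm (f w) \<le> exp 2 * norm (f z)" if w: "norm (z - w) \<le> h" for w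
    proof -
      have mem: "z \<in> cball c (3 * r)" "w \<in> cball c (3 * r)"
        using z w \<rho> hr r norm_triangle_ineq4[of "z - c" "z - w"]
        by (auto simp: dist_norm norm_minus_commute)
      then have mem': "z \<in> ball c (8 * r)" "w \<in> ball c (8 * r)" using r by auto
      have "norm (\<Prod>a\<leftarrow>as. w - a) \<le> (1 + h / \<delta>) ^ length as * norm (\<Prod>a\<leftarrow>as. z - a)"
      proof (rule norm_prod_list_le)
        fix a assume "a \<in> set as"
        then have "h * 1 \<le> h * (norm (z - a) / \<delta>)"
          using za \<delta> h by (intro mult_left_mono) (auto simp: field_simps)
        moreover have "norm (w - a) \<le> norm (z - a) + norm (z - w)"
          using norm_triangle_ineq4[of "z - a" "z - w"] by simp
        ultimately show "norm (w - a) \<le> (1 + h / \<delta>) * norm (z - a)"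
          using w by (simp add: algebra_simps)
      qed (use h \<delta> in simp)
      also have "(1 + h / \<delta>) ^ length as \<le> exp 1"
      proof -
        have "(1 + h / \<delta>) ^ length as \<le> exp (h / \<delta>) ^ length as"
          using h \<delta> by (intro power_mono exp_ge_add_one_self) auto
        also have "\<dots> = exp (real n * (h / \<delta>))" unfolding n_def by (rule exp_of_nat_mult[symmetric])
        also have "\<dots> \<le> exp 1" using h\<delta> by simp
        finally show ?thesis .
      qed
      finally have prod: "norm (\<Prod>a\<leftarrow>as. w - a) \<le> exp 1 * norm (\<Prod>a\<leftarrow>as. z - a)"
        by (simp add: mult_right_mono)
      have "norm (g w - g z) \<le> 4 * B / r * norm (w - z)"
        using mem r0 Re_g by (intro Borel_Caratheodory_increment[OF g]) (auto simp: g_def)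
      also have "\<dots> \<le> 4 * B / r * h"
        using w B r by (intro mult_left_mono) (auto simp: norm_minus_commute)
      also have "\<dots> \<le> 1" by (rule hB)
      finally have "Re (g w) \<le> 1 + Re (g z)"
        using complex_Re_le_cmod[of "g w - g z"] by simp
      then have "norm (F c) * exp (Re (g w)) \<le> norm (F c) * (exp 1 * exp (Re (g z)))"
        by (intro mult_left_mono) (simp_all flip: exp_add)
      then have "norm (F w) \<le> exp 1 * norm (F z)"
        using Fg mem' by (simp add: norm_mult mult_ac)
      from mult_mono[OF this prod] have "norm (f w) \<le> (exp 1 * exp 1) * norm (f z)"
        by (simp add: F(2) norm_mult mult_ac)
      then show ?thesis by (simp flip: exp_add)
    qed
    have "norm ((deriv ^^ j) f z) \<le> fact j * (exp 2 * norm (f z)) / h ^ j"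
      using hol h close
      by (intro Cauchy_inequality)
         (auto intro: holomorphic_on_subset holomorphic_on_imp_continuous_on continuous_on_subset)
    also have "\<dots> = fact j * exp 2 * (1 / h) ^ j * norm (f z)"
      by (simp add: power_divide)
    also have "\<dots> \<le> fact j * exp 2 * (B ^ 3) ^ j * norm (f z)"
    proof (intro mult_right_mono mult_left_mono power_mono)
      have "16 * B ^ 3 \<le> r * B ^ 3" using r B by (intro mult_right_mono) auto
      then show "1 / h \<le> B ^ 3" using r B by (simp add: h_def field_simps)
    qed (use h in auto)
    finally show "norm ((deriv ^^ j) f z) \<le> fact j * exp 2 * (b + 1) ^ (3 * j) * norm (f z)"
      by (simp add: B_def power_mult)
  qed
qed

section \<open>Growth of solutions\<close>

lemma higher_deriv_entire_has_field_derivative: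
  assumes "f holomorphic_on UNIV"
  shows "((deriv ^^ j) f has_field_derivative (deriv ^^ Suc j) f z) (at z)"
  using holomorphic_derivI[OF holomorphic_higher_deriv[OF assms open_UNIV, of j] open_UNIV, of z]
  by simp

text \<open>Let E be the sum of |f^(j)|^2, j < k, along the ray; squares keep it differentiable at
  zeros. From 2 a b \<le> a^2 + b^2, E' is at most 2 E + |f^(k)|^2, and the equation with
  Cauchy-Schwarz gives |f^(k)|^2 \<le> k P^2 E.\<close>

lemma linear_ode_growth:
  fixes f :: "complex \<Rightarrow> complex" and A :: "nat \<Rightarrow> complex \<Rightarrow> complex"
  assumes hol: "f holomorphic_on UNIV" and k: "0 < k" and r: "0 \<le> r"
    and ode: "\<And>z. (deriv ^^ k) f z + (\<Sum>j<k. A j z * (deriv ^^ j) f z) = 0"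
    and P: "\<And>j z. j < k \<Longrightarrow> norm z \<le> r \<Longrightarrow> norm (A j z) \<le> P"
    and z: "norm z = r"
  shows "(norm (f z))\<^sup>2 \<le> (\<Sum>j<k. (norm ((deriv ^^ j) f 0))\<^sup>2) * exp ((2 + real k * P\<^sup>2) * r)"
proof (cases "r = 0")
  case True
  then have "z = 0" using z by simp
  have "(norm ((deriv ^^ 0) f 0))\<^sup>2 \<le> (\<Sum>j<k. (norm ((deriv ^^ j) f 0))\<^sup>2)"
    using k by (intro member_le_sum) auto
  then show ?thesis using True \<open>z = 0\<close> by simp
next
  case False
  with r have r: "0 < r" by simp
  define u where "u = z / of_real r"
  have u: "norm u = 1" "of_real r * u = z" using z r by (auto simp: u_def norm_divide)
  define K where "K = 2 + real k * P\<^sup>2"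
  define \<phi> where "\<phi> = (\<lambda>j t. (deriv ^^ j) f (of_real t * u))"
  have \<phi>: "(\<phi> j has_vector_derivative u * \<phi> (Suc j) t) (at t)" for j t
  proof -
    have "((\<lambda>t. of_real t * u) has_vector_derivative u) (at t)"
      by (auto intro!: derivative_eq_intros)
    from field_vector_diff_chain_at[OF this higher_deriv_entire_has_field_derivative[OF hol]]
    show ?thesis by (simp add: \<phi>_def o_def)
  qed
  define E where "E = (\<lambda>t. \<Sum>j<k. \<phi> j t \<bullet> \<phi> j t)"
  define E' where "E' = (\<lambda>t. \<Sum>j<k. \<phi> j t \<bullet> (u * \<phi> (Suc j) t) + (u * \<phi> (Suc j) t) \<bullet> \<phi> j t)"
  have E: "(E has_vector_derivative E' t) (at t)" for t
    unfolding E_def E'_def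
    by (intro has_vector_derivative_sum bounded_bilinear.has_vector_derivative[OF bounded_bilinear_inner] \<phi>)
  have E'_le: "E' t \<le> K * E t" if t: "0 \<le> t" "t \<le> r" for t
  proof -
    have P': "norm (A j (of_real t * u)) \<le> P" if "j < k" for j
      using P[OF that, of "of_real t * u"] t u by (simp add: norm_mult)
    have P0: "0 \<le> P" using P'[OF k] norm_ge_zero order_trans by blast
    have E_norm: "E t = (\<Sum>j<k. (norm (\<phi> j t))\<^sup>2)" by (simp add: E_def power2_norm_eq_inner)
    have "E' t \<le> (\<Sum>j<k. (norm (\<phi> j t))\<^sup>2 + (norm (\<phi> (Suc j) t))\<^sup>2)"
      unfolding E'_def
    proof (rule sum_mono)
      fix j
      have "\<phi> j t \<bullet> (u * \<phi> (Suc j) t) \<le> norm (\<phi> j t) * norm (u * \<phi> (Suc j) t)"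
        by (rule norm_cauchy_schwarz)
      also have "\<dots> = norm (\<phi> j t) * norm (\<phi> (Suc j) t)" using u by (simp add: norm_mult)
      finally show "\<phi> j t \<bullet> (u * \<phi> (Suc j) t) + (u * \<phi> (Suc j) t) \<bullet> \<phi> j t
          \<le> (norm (\<phi> j t))\<^sup>2 + (norm (\<phi> (Suc j) t))\<^sup>2"
        using sum_squares_bound[of "norm (\<phi> j t)" "norm (\<phi> (Suc j) t)"]
        by (simp add: inner_commute)
    qed
    also have "\<dots> = E t + (\<Sum>j<k. (norm (\<phi> (Suc j) t))\<^sup>2)" by (simp add: sum.distrib E_norm)
    also have "(\<Sum>j<k. (norm (\<phi> (Suc j) t))\<^sup>2) \<le> E t + (norm (\<phi> k t))\<^sup>2"
    proof -
      have "(\<Sum>j<Suc k. (norm (\<phi> j t))\<^sup>2) = (norm (\<phi> 0 t))\<^sup>2 + (\<Sum>j<k. (norm (\<phi> (Suc j) t))\<^sup>2)"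
        by (rule sum.lessThan_Suc_shift)
      then have "(\<Sum>j<k. (norm (\<phi> (Suc j) t))\<^sup>2) \<le> (\<Sum>j<Suc k. (norm (\<phi> j t))\<^sup>2)" by simp
      then show ?thesis by (simp add: E_norm)
    qed
    also have "(norm (\<phi> k t))\<^sup>2 \<le> real k * P\<^sup>2 * E t"
    proof -
      have "\<phi> k t = - (\<Sum>j<k. A j (of_real t * u) * \<phi> j t)"
        using ode[of "of_real t * u"] unfolding \<phi>_def by (simp add: add_eq_0_iff2)
      then have "norm (\<phi> k t) \<le> (\<Sum>j<k. norm (A j (of_real t * u) * \<phi> j t))"
        by (simp add: norm_sum)
      also have "\<dots> \<le> (\<Sum>j<k. P * norm (\<phi> j t))"
        using P' by (intro sum_mono) (auto simp: norm_mult intro: mult_right_mono)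
      also have "\<dots> = P * (\<Sum>j<k. norm (\<phi> j t))" by (simp add: sum_distrib_left)
      finally have "(norm (\<phi> k t))\<^sup>2 \<le> (P * (\<Sum>j<k. norm (\<phi> j t)))\<^sup>2"
        by (intro power_mono) auto
      also have "\<dots> = P\<^sup>2 * (\<Sum>j<k. norm (\<phi> j t))\<^sup>2" by (simp add: power_mult_distrib)
      also have "\<dots> \<le> P\<^sup>2 * (real k * E t)"
        using sum_squared_le_sum_of_squares[of "\<lambda>j. norm (\<phi> j t)" "{..<k}"]
        by (intro mult_left_mono) (auto simp: E_norm mult.commute)
      finally show ?thesis by (simp add: mult_ac)
    qed
    finally show ?thesis by (simp add: K_def algebra_simps)
  qed
  define G where "G = (\<lambda>t. E t * exp (- K * t))"
  have "G r \<le> G 0"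
  proof (rule DERIV_nonpos_imp_nonincreasing[of 0 r G])
    fix t assume t: "0 \<le> t" "t \<le> r"
    have "(E has_real_derivative E' t) (at t)"
      using E by (simp add: has_real_derivative_iff_has_vector_derivative)
    then have "(G has_real_derivative (E' t - K * E t) * exp (- K * t)) (at t)"
      unfolding G_def by (auto intro!: derivative_eq_intros simp: algebra_simps)
    moreover have "(E' t - K * E t) * exp (- K * t) \<le> 0"
      using E'_le[OF t] by (intro mult_nonpos_nonneg) auto
    ultimately show "\<exists>y. (G has_real_derivative y) (at t) \<and> y \<le> 0" by blast
  qed (use r in simp)
  then have "E r \<le> E 0 * exp (K * r)" by (simp add: G_def exp_minus field_simps)
  moreover have "(norm (f z))\<^sup>2 \<le> E r"
  proof -
    have "(norm (\<phi> 0 r))\<^sup>2 \<le> (\<Sum>j<k. (norm (\<phi> j r))\<^sup>2)"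
      using k by (intro member_le_sum) auto
    then show ?thesis using u by (simp add: E_def \<phi>_def power2_norm_eq_inner)
  qed
  moreover have "E 0 = (\<Sum>j<k. (norm ((deriv ^^ j) f 0))\<^sup>2)"
    by (simp add: E_def \<phi>_def power2_norm_eq_inner)
  ultimately show ?thesis by (simp add: K_def)
qed

text \<open>The coefficients are at most exp (3 S) on the disc, with S the sum of their
  characteristics at \<open>2 * r\<close>. So log |f| is at most of order r exp (6 S), and a further
  logarithm makes this linear in S and log r.\<close>

lemma ln_nevanlinna_T_solution_le:
  fixes A :: "nat \<Rightarrow> complex \<Rightarrow> complex"
  assumes A: "\<And>j. j < k \<Longrightarrow> A j holomorphic_on UNIV" and f: "f holomorphic_on UNIV" and k: "0 < k"
    and ode: "\<And>z. (deriv ^^ k) f z + (\<Sum>j<k. A j z * (deriv ^^ j) f z) = 0"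
  obtains C where "0 \<le> C"
    "\<And>r. 1 \<le> r \<Longrightarrow> ln (nevanlinna_T r f) \<le>
       C * (1 + ln r + (\<Sum>j<k. max 1 (nevanlinna_T (2 * r) (A j))))"
proof -
  define E where "E = (\<Sum>j<k. (norm ((deriv ^^ j) f 0))\<^sup>2)"
  have E: "0 \<le> E" unfolding E_def by (intro sum_nonneg) auto
  \<comment> \<open>\<open>E + 2 + real k\<close> collects the coefficients of
    \<open>E + K * r\<close> once \<open>exp (6 * S) * r\<close> is factored out; 6 is twice the 3
    from comparing maximum modulus and characteristic.\<close>
  define C where "C = ln (E + 2 + real k) + 6"
  have C: "6 \<le> C" using E by (simp add: C_def)
  have "ln (nevanlinna_T r f) \<le> C * (1 + ln r + (\<Sum>j<k. max 1 (nevanlinna_T (2 * r) (A j))))"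
    if r: "1 \<le> r" for r
  proof -
    define S where "S = (\<Sum>j<k. nevanlinna_T (2 * r) (A j))"
    have S0: "0 \<le> S" unfolding S_def by (intro sum_nonneg nevanlinna_T_nonneg A) auto
    have S_le: "S \<le> (\<Sum>j<k. max 1 (nevanlinna_T (2 * r) (A j)))"
      unfolding S_def by (intro sum_mono) auto
    define K where "K = 2 + real k * (exp (3 * S))\<^sup>2"
    have P: "norm (A j z) \<le> exp (3 * S)" if j: "j < k" and z: "norm z \<le> r" for j and z :: complex
    proof -
      have "nevanlinna_T (2 * r) (A j) \<le> S"
        unfolding S_def using j A by (intro member_le_sum nevanlinna_T_nonneg) auto
      then show ?thesis
        using norm_le_exp_nevanlinna_T[OF A[OF j] _ z] r
        by (smt (verit) exp_le_cancel_iff)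
    qed
    have "nevanlinna_T r f \<le> E + K * r"
    proof (rule nevanlinna_T_le[OF f])
      fix z :: complex assume z: "norm z = r"
      have "(norm (f z))\<^sup>2 \<le> E * exp (K * r)"
        unfolding E_def K_def using r by (intro linear_ode_growth[OF f k _ ode P z]) auto
      also have "\<dots> \<le> exp E * exp (K * r)"
      proof (rule mult_right_mono)
        show "E \<le> exp E" using exp_ge_add_one_self[of E] by linarith
      qed simp
      also have "\<dots> = exp (E + K * r)" by (simp add: exp_add)
      also have "\<dots> \<le> (exp (E + K * r))\<^sup>2"
        using E r by (intro self_le_power) (auto simp: K_def)
      finally show "norm (f z) \<le> exp (E + K * r)"
        by (rule power2_le_imp_le) simp
    qed (use E r in \<open>auto simp: K_def\<close>)
    also have "\<dots> \<le> (E + 2 + real k) * exp (6 * S) * r"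
    proof -
      have 1: "1 \<le> exp (6 * S)" using S0 by simp
      have "(exp (3 * S))\<^sup>2 = exp (6 * S)" by (simp add: power2_eq_square flip: exp_add)
      then have K: "K = 2 + real k * exp (6 * S)" by (simp add: K_def)
      have "E * 1 \<le> E * (exp (6 * S) * r)"
        using 1 r E mult_mono[of 1 "exp (6 * S)" 1 r] by (intro mult_left_mono) auto
      moreover have "2 * r \<le> 2 * (exp (6 * S) * r)" using 1 r by simp
      ultimately show ?thesis by (simp add: K algebra_simps)
    qed
    finally have T: "nevanlinna_T r f \<le> (E + 2 + real k) * exp (6 * S) * r" .
    have "ln (nevanlinna_T r f) \<le> ln (E + 2 + real k) + 6 * S + ln r"
    proof (cases "nevanlinna_T r f = 0")
      case True
      then show ?thesis using E r S0 by simp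
    next
      case False
      then have "ln (nevanlinna_T r f) \<le> ln ((E + 2 + real k) * exp (6 * S) * r)"
        using T nevanlinna_T_nonneg[OF f, of r] by (intro ln_mono) auto
      also have "\<dots> = ln (E + 2 + real k) + 6 * S + ln r"
        using E r by (simp add: ln_mult)
      finally show ?thesis .
    qed
    also have "\<dots> \<le> C * 1 + C * S + C * ln r"
      using C S0 r mult_right_mono[of 6 C S] mult_right_mono[of 1 C "ln r"]
      by (simp add: C_def)
    also have "\<dots> = C * (1 + ln r + S)" by (simp add: algebra_simps)
    also have "\<dots> \<le> C * (1 + ln r + (\<Sum>j<k. max 1 (nevanlinna_T (2 * r) (A j))))"
      using S_le C by (intro mult_left_mono) auto
    finally show ?thesis .
  qed
  with C show thesis by (intro that[of C]) auto
qed

text \<open>Dividing the equation by \<open>f\<close> on a zero-avoiding circle bounds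
  \<open>A 0\<close> by the other coefficients times a power of the characteristic of
  \<open>f\<close>; in the logarithm that power becomes a multiple of
  \<open>ln (nevanlinna_T (100 * r) f)\<close>.\<close>

lemma nevanlinna_T_coefficient_le:
  fixes A :: "nat \<Rightarrow> complex \<Rightarrow> complex"
  assumes A: "\<And>j. j < k \<Longrightarrow> A j holomorphic_on UNIV" and f: "f holomorphic_on UNIV" and k: "0 < k"
    and nz: "f c \<noteq> 0"
    and ode: "\<And>z. (deriv ^^ k) f z + (\<Sum>j<k. A j z * (deriv ^^ j) f z) = 0"
  obtains C where "0 \<le> C"
    "\<And>r. max 8 (norm c) \<le> r \<Longrightarrow> nevanlinna_T r (A 0) \<le>
       C * (1 + ln r + ((\<Sum>j=1..<k. max 1 (nevanlinna_T (100 * r) (A j))) +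
          max 1 (ln (nevanlinna_T (100 * r) f))))"
proof -
  \<comment> \<open>Compensates for a small |f(c)|: \<open>ln (norm (f c)) + K\<close> is
    nonnegative, so exp (3 t) \<le> |f(c)| exp (3 t + K).\<close>
  define K where "K = \<bar>ln (norm (f c))\<bar>"
  define C0 where "C0 = ln (real k) + ln (fact k) + 2 + 3 * real k * ln (4 + K)"
  define C where "C = C0 + 3 * real k + 3"
  have K: "0 \<le> K" by (simp add: K_def)
  have C0: "0 \<le> C0" using K k by (simp add: C0_def)
  then have C: "0 \<le> C" by (simp add: C_def)
  have "nevanlinna_T r (A 0) \<le>
       C * (1 + ln r + ((\<Sum>j=1..<k. max 1 (nevanlinna_T (100 * r) (A j))) +
          max 1 (ln (nevanlinna_T (100 * r) f))))" if r: "max 8 (norm c) \<le> r" for r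
  proof -
    define t where "t = nevanlinna_T (100 * r) f"
    define S where "S = (\<Sum>j=1..<k. nevanlinna_T (100 * r) (A j))"
    have t0: "0 \<le> t" unfolding t_def by (rule nevanlinna_T_nonneg[OF f])
    have S0: "0 \<le> S" unfolding S_def by (intro sum_nonneg nevanlinna_T_nonneg A) auto
    have r8: "8 \<le> r" "norm c \<le> r" using r by auto
    define b where "b = 3 * t + K"
    define B where "B = b + 1"
    have B: "1 \<le> B" using t0 K by (simp add: B_def b_def)
    obtain \<rho> where \<rho>: "2 * r \<le> \<rho>" "\<rho> \<le> 2 * (2 * r)"
      "\<And>z. z \<in> sphere c \<rho> \<Longrightarrow> f z \<noteq> 0"
      "\<And>z j. z \<in> sphere c \<rho> \<Longrightarrow>
        norm ((deriv ^^ j) f z) \<le> fact j * exp 2 * B ^ (3 * j) * norm (f z)"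
    proof (rule higher_deriv_quotient_bound[OF f nz, of "2 * r" b])
      fix z assume "z \<in> cball c (24 * (2 * r))"
      \<comment> \<open>Here |z| is at most 48 r + |c| \<le> 49 r; passing from maximum modulus to
        characteristic doubles the radius, whence \<open>100 * r\<close>.\<close>
      then have "norm z \<le> 50 * r"
        using norm_triangle_ineq4[of c "c - z"] r8 by (simp add: dist_norm)
      then have "norm (f z) \<le> exp (3 * t)"
        using norm_le_exp_nevanlinna_T[OF f, of "50 * r" z] r8 by (simp add: t_def)
      also have "\<dots> \<le> exp (ln (norm (f c)) + b)" by (simp add: b_def K_def)
      also have "\<dots> = norm (f c) * exp b" using nz by (simp add: exp_add)
      finally show "norm (f z) \<le> norm (f c) * exp b" .
    qed (use r8 t0 K in \<open>auto simp: b_def B_def\<close>)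
    define Q where "Q = fact k * exp 2 * B ^ (3 * k)"
    have Q: "0 < Q" using B by (simp add: Q_def)
    define X where "X = ln (real k) + ln Q + 3 * S"
    have "1 \<le> Q"
    proof -
      have "1 * 1 \<le> fact k * (exp 2 :: real)" by (intro mult_mono) auto
      from mult_mono[OF this one_le_power[OF B, of "3 * k"]] show ?thesis by (simp add: Q_def)
    qed
    then have X0: "0 \<le> X" using k S0 by (simp add: X_def)
    have circle: "norm (A 0 z) \<le> exp X" if z: "z \<in> sphere c \<rho>" for z
    proof -
      have der: "norm ((deriv ^^ j) f z) \<le> Q * norm (f z)" if "j \<le> k" for j
      proof -
        have "fact j * exp 2 * B ^ (3 * j) \<le> Q"
          unfolding Q_def using that B
          by (intro mult_mono power_increasing fact_mono) auto
        then show ?thesis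
          using \<rho>(4)[OF z, of j] by (meson mult_right_mono norm_ge_zero order_trans)
      qed
      have z50: "norm z \<le> 50 * r"
        using norm_triangle_ineq4[of c "c - z"] r8 \<rho> z by (simp add: dist_norm)
      have Aj: "norm (A j z) \<le> exp (3 * S)" if j: "j \<in> {1..<k}" for j
      proof -
        have "nevanlinna_T (100 * r) (A j) \<le> S"
          unfolding S_def using j A by (intro member_le_sum nevanlinna_T_nonneg) auto
        then have "exp (3 * nevanlinna_T (100 * r) (A j)) \<le> exp (3 * S)" by simp
        moreover have "norm (A j z) \<le> exp (3 * nevanlinna_T (100 * r) (A j))"
          using norm_le_exp_nevanlinna_T[of "A j" "50 * r" z] A[of j] j z50 r8 by simp
        ultimately show ?thesis by (rule order_trans[rotated])
      qed
      have split: "(\<Sum>j<k. A j z * (deriv ^^ j) f z) =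
          A 0 z * f z + (\<Sum>j=1..<k. A j z * (deriv ^^ j) f z)"
        using k by (simp add: lessThan_atLeast0 sum.atLeast_Suc_lessThan)
      have "A 0 z * f z = - ((deriv ^^ k) f z + (\<Sum>j=1..<k. A j z * (deriv ^^ j) f z))"
        using ode[of z] unfolding split eq_neg_iff_add_eq_0 by (simp only: add_ac)
      then have "norm (A 0 z) * norm (f z)
          \<le> norm ((deriv ^^ k) f z) + norm (\<Sum>j=1..<k. A j z * (deriv ^^ j) f z)"
        by (simp only: norm_mult[symmetric] norm_minus_cancel norm_triangle_ineq)
      also have "\<dots> \<le> exp (3 * S) * (Q * norm (f z)) + (\<Sum>j=1..<k. exp (3 * S) * (Q * norm (f z)))"
      proof (intro add_mono order_trans[OF norm_sum] sum_mono)
        \<comment> \<open>The leading derivative has coefficient 1 \<le> exp (3 S), so it joins the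
          other k - 1 terms under the same bound.\<close>
        have "1 * (Q * norm (f z)) \<le> exp (3 * S) * (Q * norm (f z))"
          using S0 Q by (intro mult_right_mono) auto
        then show "norm ((deriv ^^ k) f z) \<le> exp (3 * S) * (Q * norm (f z))"
          using der[of k] by simp
        fix j assume "j \<in> {1..<k}"
        then show "norm (A j z * (deriv ^^ j) f z) \<le> exp (3 * S) * (Q * norm (f z))"
          unfolding norm_mult using Aj[of j] der[of j] by (intro mult_mono) auto
      qed
      also have "\<dots> = real k * Q * exp (3 * S) * norm (f z)"
        using k by (simp add: algebra_simps of_nat_diff)
      finally have "norm (A 0 z) \<le> real k * Q * exp (3 * S)"
        using \<rho>(3)[OF z] by (simp add: mult_le_cancel_right)
      also have "\<dots> = exp X" using k Q by (simp add: X_def exp_add)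
      finally show ?thesis .
    qed
    have "nevanlinna_T r (A 0) \<le> X"
    proof (rule nevanlinna_T_le)
      fix z :: complex assume z: "norm z = r"
      \<comment> \<open>As \<open>norm c \<le> r\<close> and \<open>2 * r \<le> \<rho>\<close>, the
        disc about \<open>c\<close> contains the circle |z| = r.\<close>
      show "norm (A 0 z) \<le> exp X"
      proof (rule maximum_modulus_frontier[of "A 0" "cball c \<rho>"])
        show "norm (A 0 w) \<le> exp X" if "w \<in> frontier (cball c \<rho>)" for w
          using circle[of w] that r8 \<rho> by simp
        show "z \<in> cball c \<rho>"
          using norm_triangle_ineq4[of c z] z r8 \<rho> by (simp add: dist_norm)
      qed (use A[OF k] in \<open>auto intro: holomorphic_on_subset holomorphic_on_imp_continuous_on
              continuous_on_subset\<close>)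
    qed (use A k r8 X0 in auto)
    also have "X \<le> C0 + 3 * real k * max 1 (ln t) + 3 * S"
    proof -
      have "B \<le> (4 + K) * max 1 t"
        using K t0 mult_left_mono[of 1 "max 1 t" "K + 1"]
        by (simp add: B_def b_def algebra_simps)
      then have "ln B \<le> ln ((4 + K) * max 1 t)" using B by (intro ln_mono) auto
      also have "\<dots> = ln (4 + K) + ln (max 1 t)" using K by (subst ln_mult) auto
      also have "ln (max 1 t) \<le> max 1 (ln t)" by (auto simp: max_def)
      finally have "3 * real k * ln B \<le> 3 * real k * (ln (4 + K) + max 1 (ln t))"
        by (intro mult_left_mono) auto
      moreover have "ln Q = ln (fact k) + 2 + 3 * real k * ln B"
        using B by (simp add: Q_def ln_mult ln_realpow)
      ultimately show ?thesis by (simp add: X_def C0_def algebra_simps)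
    qed
    also have "\<dots> \<le> C * 1 + C * max 1 (ln t) + C * S"
      using C0 S0 by (intro add_mono mult_right_mono) (auto simp: C_def)
    also have "\<dots> = C * (1 + (S + max 1 (ln t)))" by (simp add: algebra_simps)
    also have "\<dots> \<le> C * (1 + ln r + ((\<Sum>j=1..<k. max 1 (nevanlinna_T (100 * r) (A j))) + max 1 (ln t)))"
    proof (rule mult_left_mono[OF _ C])
      have "S \<le> (\<Sum>j=1..<k. max 1 (nevanlinna_T (100 * r) (A j)))"
        unfolding S_def by (intro sum_mono) auto
      moreover have "0 \<le> ln r" using r8 by simp
      ultimately show "1 + (S + max 1 (ln t)) \<le>
          1 + ln r + ((\<Sum>j=1..<k. max 1 (nevanlinna_T (100 * r) (A j))) + max 1 (ln t))"
        by linarith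
    qed
    finally show ?thesis by (simp only: t_def)
  qed
  with C show thesis by (rule that)
qed

section \<open>Comparison of generalized orders\<close>

lemma class_L_mono:
  assumes "\<alpha> \<in> class_L"
  shows "mono \<alpha>"
proof
  fix x y :: real assume xy: "x \<le> y"
  obtain x0 where x0: "\<And>x. x \<le> x0 \<Longrightarrow> \<alpha> x = \<alpha> x0" "strict_mono_on {x0..} \<alpha>"
    using assms unfolding class_L_def by blast
  have *: "\<alpha> u \<le> \<alpha> v" if "x0 \<le> u" "u \<le> v" for u v
    using strict_mono_on_leD[OF x0(2), of u v] that by simp
  show "\<alpha> x \<le> \<alpha> y"
    using *[of x y] *[of x0 y] x0(1)[of x] x0(1)[of y] xy by linarith
qed

lemma class_L_nonneg: "\<alpha> \<in> class_L \<Longrightarrow> 0 \<le> \<alpha> x"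
  by (simp add: class_L_def)

lemma class_L_at_top: "\<alpha> \<in> class_L \<Longrightarrow> filterlim \<alpha> at_top at_top"
  by (simp add: class_L_def)

lemma filterlim_beta_ln_gamma:
  assumes "\<beta> \<in> class_L" "\<gamma> \<in> class_L"
  shows "filterlim (\<lambda>r. \<beta> (ln (\<gamma> r))) at_top at_top"
  by (intro filterlim_compose[OF class_L_at_top[OF assms(1)]]
      filterlim_compose[OF ln_at_top class_L_at_top[OF assms(2)]])

text \<open>Repeated subadditivity gives \<gamma>(c r) \<le> c \<gamma>(r) for integer c. Under the
  logarithm this is a shift by the constant log c, which changes \<beta> only by a factor 1 +
  o(1).\<close>

lemma eventually_beta_ln_gamma_scale_le:
  assumes \<beta>: "\<beta> \<in> class_L2" and \<gamma>: "\<gamma> \<in> class_L3" and c: "1 \<le> c" and e: "0 < e"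
  shows "eventually (\<lambda>r. \<beta> (ln (\<gamma> (real c * r))) \<le> (1 + e) * \<beta> (ln (\<gamma> r))) at_top"
proof -
  have L: "\<beta> \<in> class_L" "\<gamma> \<in> class_L"
    using \<beta> \<gamma> by (auto simp: class_L2_def class_L3_def)
  obtain R0 where R0: "\<And>a b. R0 \<le> a \<Longrightarrow> R0 \<le> b \<Longrightarrow> \<gamma> (a + b) \<le> \<gamma> a + \<gamma> b"
    using \<gamma> unfolding class_L3_def by blast
  have scale: "\<gamma> (real c * r) \<le> real c * \<gamma> r" if r: "max 0 R0 \<le> r" for r
    using c
  proof (induction c rule: dec_induct)
    case (step n)
    have "R0 \<le> real n * r"
      using r step.hyps mult_right_mono[of 1 "real n" r] by simp
    with R0[of "real n * r" r] step.IH r show ?case by (simp add: algebra_simps)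
  qed simp
  have "(\<lambda>_. ln (real c)) \<in> O[at_top](\<lambda>_. 1 :: real)" by simp
  with \<beta> have "(\<lambda>x. \<beta> (x + ln (real c))) \<sim>[at_top] \<beta>"
    unfolding class_L2_def by (auto dest!: bspec[of _ _ "\<lambda>_. ln (real c)"])
  then have "(\<lambda>x. \<beta> (x + ln (real c)) - \<beta> x) \<in> o[at_top](\<beta>)"
    by (simp add: asymp_equiv_altdef)
  from landau_o.smallD[OF this e]
  have "eventually (\<lambda>x. \<beta> (x + ln (real c)) \<le> (1 + e) * \<beta> x) at_top"
    by eventually_elim (use class_L_nonneg[OF L(1)] in \<open>auto simp: abs_le_iff algebra_simps\<close>)
  then have ev: "eventually (\<lambda>r. \<beta> (ln (\<gamma> r) + ln (real c)) \<le> (1 + e) * \<beta> (ln (\<gamma> r))) at_top"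
    using filterlim_compose[OF ln_at_top class_L_at_top[OF L(2)]]
    by (rule eventually_compose_filterlim)
  have "eventually (\<lambda>r. 0 < \<gamma> r) at_top"
    using class_L_at_top[OF L(2)] by (simp add: filterlim_at_top_dense)
  then show ?thesis
    using ev eventually_ge_at_top[of "max 0 R0"]
  proof eventually_elim
    case (elim r)
    \<comment> \<open>Gives positivity of the right-hand side, needed for monotonicity of
      \<open>ln\<close>.\<close>
    have "\<gamma> r \<le> \<gamma> (real c * r)"
      using elim c mult_right_mono[of 1 "real c" r] by (intro monoD[OF class_L_mono[OF L(2)]]) auto
    then have "ln (\<gamma> (real c * r)) \<le> ln (real c * \<gamma> r)"
      using scale[of r] elim by simp
    also have "\<dots> = ln (\<gamma> r) + ln (real c)"
      using elim c by (simp add: ln_mult)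
    finally have "\<beta> (ln (\<gamma> (real c * r))) \<le> \<beta> (ln (\<gamma> r) + ln (real c))"
      by (rule monoD[OF class_L_mono[OF L(1)]])
    with elim show ?case by linarith
  qed
qed

text \<open>The sum is at most a constant times its largest term W. Near-subadditivity of \<alpha>
  turns that constant into an additive one, negligible against \<beta>(log \<gamma>(r)), while
  \<alpha>(log W) is the value at a single term: 1, log r (covered by \<open>small\<close>) or some
  V_i.\<close>

lemma eventually_order_ratio_le:
  fixes U :: "real \<Rightarrow> real" and V :: "'i \<Rightarrow> real \<Rightarrow> real"
  assumes \<alpha>: "\<alpha> \<in> class_L1" and \<beta>: "\<beta> \<in> class_L2" and \<gamma>: "\<gamma> \<in> class_L3"
    and small: "(\<lambda>r. \<alpha> (ln (ln r))) \<in> o[at_top](\<lambda>r. \<beta> (ln (\<gamma> r)))"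
    and I: "finite I" and c: "1 \<le> c" and C: "0 \<le> C"
    and U: "eventually (\<lambda>r. U r \<le> C * (1 + ln r + (\<Sum>i\<in>I. max 1 (V i (real c * r))))) at_top"
    and V: "\<And>i. i \<in> I \<Longrightarrow> eventually (\<lambda>r. \<alpha> (ln (V i r)) \<le> y' * \<beta> (ln (\<gamma> r))) at_top"
    and y: "0 \<le> y'" "y' < y"
  shows "eventually (\<lambda>r. \<alpha> (ln (max 1 (U r))) \<le> y * \<beta> (ln (\<gamma> r))) at_top"
proof -
  have L: "\<alpha> \<in> class_L" "\<beta> \<in> class_L" "\<gamma> \<in> class_L"
    using \<alpha> \<beta> \<gamma> by (auto simp: class_L1_def class_L2_def class_L3_def)
  note mono = monoD[OF class_L_mono[OF L(1)]]
  obtain k R0 where kR0: "\<And>a b. R0 \<le> a \<Longrightarrow> R0 \<le> b \<Longrightarrow> \<alpha> (a + b) \<le> \<alpha> a + \<alpha> b + k"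
    using \<alpha> unfolding class_L1_def by blast
  \<comment> \<open>Three errors share the gap between \<open>y'\<close> and \<open>y\<close>: the
    factor 1 + e from rescaling r, one e for log r, and one e for the additive constants.\<close>
  define e where "e = (y - y') / (y' + 3)"
  have e0: "0 < e" "e * (y' + 3) = y - y'" using y by (simp_all add: e_def)
  then have e: "0 < e" "y' * (1 + e) + 2 * e \<le> y" by (simp_all add: algebra_simps)
  define C' where "C' = max 1 (C * real (card I + 2))"
  \<comment> \<open>Dominates \<open>ln C'\<close> and keeps both summands in the range where
    near-subadditivity is available.\<close>
  define R where "R = max R0 (ln C')"
  define D where "D = 2 * \<alpha> R + k + \<alpha> 0"
  have V': "eventually (\<lambda>r. \<forall>i\<in>I. \<alpha> (ln (V i (real c * r))) \<le> y' * \<beta> (ln (\<gamma> (real c * r)))) at_top"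
  proof -
    have "filterlim (\<lambda>r. real c * r) at_top at_top"
      using c by (intro filterlim_tendsto_pos_mult_at_top[of _ "real c"]) (auto intro: filterlim_ident)
    then show ?thesis
      using eventually_compose_filterlim[OF V] I by (auto intro!: eventually_ball_finite)
  qed
  have D: "eventually (\<lambda>r. D / e \<le> \<beta> (ln (\<gamma> r))) at_top"
    using filterlim_beta_ln_gamma[OF L(2,3)] by (simp add: filterlim_at_top)
  show ?thesis
    using U V' D landau_o.smallD[OF small e(1)] eventually_gt_at_top[of 1]
      eventually_beta_ln_gamma_scale_le[OF \<beta> \<gamma> c e(1)]
  proof eventually_elim
    case (elim r)
    define B where "B = \<beta> (ln (\<gamma> r))"
    have B: "0 \<le> B" by (simp add: B_def class_L_nonneg L)
    define Z where "Z = \<alpha> 0 + (y' * (1 + e) * B + e * B)"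
    define W where "W = Max (insert 1 (insert (ln r) ((\<lambda>i. V i (real c * r)) ` I)))"
    have fin: "finite (insert 1 (insert (ln r) ((\<lambda>i. V i (real c * r)) ` I)))"
      using I by simp
    have Z0: "0 \<le> y' * (1 + e) * B + e * B"
      using y e B by simp
    have "W \<in> insert 1 (insert (ln r) ((\<lambda>i. V i (real c * r)) ` I))"
      unfolding W_def using fin by (intro Max_in) auto
    moreover have "1 \<le> W" "ln r \<le> W" and WV: "\<And>i. i \<in> I \<Longrightarrow> V i (real c * r) \<le> W"
      unfolding W_def by (rule Max_ge[OF fin], blast)+
    moreover have "\<alpha> (ln 1) \<le> Z" using Z0 by (simp add: Z_def)
    moreover have "\<alpha> (ln (ln r)) \<le> Z"
    proof -
      have "\<alpha> (ln (ln r)) \<le> e * B" using elim(4) B by (simp add: B_def)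
      moreover have "0 \<le> y' * (1 + e) * B" using y e B by simp
      ultimately show ?thesis using class_L_nonneg[OF L(1), of 0] unfolding Z_def by linarith
    qed
    moreover have "\<alpha> (ln (V i (real c * r))) \<le> Z" if "i \<in> I" for i
    proof -
      have "\<alpha> (ln (V i (real c * r))) \<le> y' * \<beta> (ln (\<gamma> (real c * r)))"
        using elim that by blast
      also have "\<dots> \<le> y' * ((1 + e) * B)"
        using elim y by (intro mult_left_mono) (auto simp: B_def)
      finally have "\<alpha> (ln (V i (real c * r))) \<le> y' * (1 + e) * B" by (simp add: mult_ac)
      moreover have "0 \<le> e * B" using e B by simp
      ultimately show ?thesis using class_L_nonneg[OF L(1), of 0] unfolding Z_def by linarith
    qed
    ultimately have W: "1 \<le> W" "ln r \<le> W" "\<alpha> (ln W) \<le> Z" by auto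
    have "(\<Sum>i\<in>I. max 1 (V i (real c * r))) \<le> (\<Sum>i\<in>I. W)"
      using WV W by (intro sum_mono) auto
    then have "1 + ln r + (\<Sum>i\<in>I. max 1 (V i (real c * r))) \<le> real (card I + 2) * W"
      using W by (simp add: algebra_simps)
    then have "U r \<le> C * (real (card I + 2) * W)"
      using elim(1) mult_left_mono[OF _ C] order_trans by blast
    also have "\<dots> \<le> C' * W"
      using W by (auto simp: C'_def mult.assoc[symmetric] intro!: mult_right_mono)
    finally have "max 1 (U r) \<le> C' * W"
      using W mult_mono[of 1 C' 1 W] by (simp add: C'_def)
    then have "ln (max 1 (U r)) \<le> ln (C' * W)" by (intro ln_mono) auto
    also have "\<dots> = ln C' + ln W" using W by (subst ln_mult) (auto simp: C'_def)
    also have "\<dots> \<le> R + max R (ln W)" by (simp add: R_def)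
    finally have "\<alpha> (ln (max 1 (U r))) \<le> \<alpha> (R + max R (ln W))" by (rule mono)
    also have "\<dots> \<le> \<alpha> R + \<alpha> (max R (ln W)) + k" by (intro kR0) (auto simp: R_def)
    also have "\<alpha> (max R (ln W)) \<le> \<alpha> R + \<alpha> (ln W)"
      using class_L_nonneg[OF L(1)] by (auto simp: max_def)
    finally have "\<alpha> (ln (max 1 (U r))) \<le> D + (y' * (1 + e) * B + e * B)"
      using W unfolding D_def Z_def by linarith
    also have "D \<le> e * B" using elim(3) e by (simp add: B_def field_simps)
    finally have "\<alpha> (ln (max 1 (U r))) \<le> (y' * (1 + e) + 2 * e) * B" by (simp add: algebra_simps)
    also have "\<dots> \<le> y * B" using e B by (intro mult_right_mono) auto
    finally show ?case by (simp add: B_def)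
  qed
qed

lemma Limsup_order_ratio_le:
  fixes U :: "real \<Rightarrow> real" and V :: "'i \<Rightarrow> real \<Rightarrow> real"
  assumes \<alpha>: "\<alpha> \<in> class_L1" and \<beta>: "\<beta> \<in> class_L2" and \<gamma>: "\<gamma> \<in> class_L3"
    and small: "(\<lambda>r. \<alpha> (ln (ln r))) \<in> o[at_top](\<lambda>r. \<beta> (ln (\<gamma> r)))"
    and I: "finite I" and c: "1 \<le> c" and C: "0 \<le> C"
    and U: "eventually (\<lambda>r. U r \<le> C * (1 + ln r + (\<Sum>i\<in>I. max 1 (V i (real c * r))))) at_top"
    and V: "\<And>i. i \<in> I \<Longrightarrow> Limsup at_top (\<lambda>r. ereal (\<alpha> (ln (V i r)) / \<beta> (ln (\<gamma> r)))) \<le> s"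
    and s: "0 \<le> s"
  shows "Limsup at_top (\<lambda>r. ereal (\<alpha> (ln (max 1 (U r))) / \<beta> (ln (\<gamma> r)))) \<le> s"
proof (rule dense_ge)
  fix y assume y: "s < y"
  show "Limsup at_top (\<lambda>r. ereal (\<alpha> (ln (max 1 (U r))) / \<beta> (ln (\<gamma> r)))) \<le> y"
  proof (cases "y = \<infinity>")
    case False
    with y s obtain yr sr where r: "y = ereal yr" "s = ereal sr" "0 \<le> sr" "sr < yr"
      by (cases y; cases s) auto
    define y' where "y' = (sr + yr) / 2"
    have y': "0 \<le> y'" "sr < y'" "y' < yr" using r by (auto simp: y'_def field_simps)
    have L: "\<beta> \<in> class_L" "\<gamma> \<in> class_L"
      using \<beta> \<gamma> by (auto simp: class_L2_def class_L3_def)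
    have pos: "eventually (\<lambda>r. 0 < \<beta> (ln (\<gamma> r))) at_top"
      using filterlim_beta_ln_gamma[OF L] by (simp add: filterlim_at_top_dense)
    have "eventually (\<lambda>r. \<alpha> (ln (max 1 (U r))) \<le> yr * \<beta> (ln (\<gamma> r))) at_top"
    proof (rule eventually_order_ratio_le[OF \<alpha> \<beta> \<gamma> small I c C U _ y'(1,3)])
      fix i assume "i \<in> I"
      then have "Limsup at_top (\<lambda>r. ereal (\<alpha> (ln (V i r)) / \<beta> (ln (\<gamma> r)))) < ereal y'"
        using V[of i] r y' by (auto intro: le_less_trans)
      from Limsup_lessD[OF this] pos
      show "eventually (\<lambda>r. \<alpha> (ln (V i r)) \<le> y' * \<beta> (ln (\<gamma> r))) at_top"
        by eventually_elim (simp add: field_simps)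
    qed
    then have "eventually (\<lambda>r. ereal (\<alpha> (ln (max 1 (U r))) / \<beta> (ln (\<gamma> r))) \<le> y) at_top"
      using pos unfolding r by eventually_elim (simp add: divide_le_eq)
    then show ?thesis by (rule Limsup_bounded)
  qed simp
qed

text \<open>Arbitrarily large good radii suffice: every \<open>z\<close> lies within half of one of
  them, so |f| is bounded by exp (3 b) and Liouville's theorem applies.\<close>

lemma nevanlinna_T_bounded_imp_constant:
  assumes f: "f holomorphic_on UNIV" and freq: "frequently (\<lambda>r. nevanlinna_T r f \<le> b) at_top"
  obtains c where "f = (\<lambda>_. c)"
proof -
  have "norm (f z) \<le> exp (3 * b)" for z
  proof -
    have "frequently (\<lambda>r. nevanlinna_T r f \<le> b \<and> max 1 (2 * norm z) \<le> r) at_top"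
      using freq eventually_mono[OF eventually_ge_at_top[of "max 1 (2 * norm z)"]]
      by (rule frequently_rev_mp) simp
    then obtain r where r: "nevanlinna_T r f \<le> b" "max 1 (2 * norm z) \<le> r"
      by (auto dest: frequently_ex)
    then have "norm (f z) \<le> exp (3 * nevanlinna_T r f)"
      using norm_le_exp_nevanlinna_T[OF f, of "r / 2" z] by simp
    also have "\<dots> \<le> exp (3 * b)" using r by simp
    finally show ?thesis .
  qed
  then have "bounded (range f)" by (auto simp: bounded_iff)
  from Liouville_theorem[OF f this] show thesis
    using that by (auto simp: constant_on_def)
qed

lemma abg_order_nonneg:
  assumes "\<alpha> \<in> class_L" "\<beta> \<in> class_L"
  shows "0 \<le> abg_order \<alpha> \<beta> \<gamma> f"
  unfolding abg_order_def
  by (intro le_Limsup always_eventually allI) (auto simp: class_L_nonneg assms)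

text \<open>On a bounded characteristic the iterated \<open>ln\<close> may take junk values
  (note \<open>ln (- x) = ln x\<close>); by Liouville's theorem this concerns only constants.\<close>

lemma abg_log_order_le_max:
  assumes \<alpha>: "\<alpha> \<in> class_L" and \<beta>: "\<beta> \<in> class_L" and \<gamma>: "\<gamma> \<in> class_L"
    and f: "f holomorphic_on UNIV" and s: "0 \<le> s"
    and le: "Limsup at_top (\<lambda>r. ereal (\<alpha> (ln (max 1 (ln (nevanlinna_T r f)))) / \<beta> (ln (\<gamma> r)))) \<le> s"
  shows "abg_log_order \<alpha> \<beta> \<gamma> f \<le> s"
proof (cases "frequently (\<lambda>r. nevanlinna_T r f \<le> exp 1) at_top")
  case True
  then obtain c where c: "f = (\<lambda>_. c)"
    using nevanlinna_T_bounded_imp_constant[OF f] by blast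
  \<comment> \<open>For a constant the numerator does not depend on \<open>r\<close>, whatever its
    value, and the denominator tends to infinity.\<close>
  have T: "nevanlinna_T r f = nevanlinna_T 1 f" for r
    unfolding nevanlinna_T_entire[OF f] nevanlinna_m_def by (simp add: c)
  have "((\<lambda>r. \<alpha> ((ln ^^ 2) (nevanlinna_T 1 f)) / \<beta> (ln (\<gamma> r))) \<longlongrightarrow> 0) at_top"
    by (rule real_tendsto_divide_at_top[OF tendsto_const filterlim_beta_ln_gamma[OF \<beta> \<gamma>]])
  then have "((\<lambda>r. \<alpha> ((ln ^^ 2) (nevanlinna_T r f)) / \<beta> (ln (\<gamma> r))) \<longlongrightarrow> 0) at_top"
    by (subst T)
  then have "((\<lambda>r. ereal (\<alpha> ((ln ^^ 2) (nevanlinna_T r f)) / \<beta> (ln (\<gamma> r)))) \<longlongrightarrow> ereal 0) at_top"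
    by (rule tendsto_ereal)
  then have "abg_log_order \<alpha> \<beta> \<gamma> f = ereal 0"
    unfolding abg_log_order_def by (intro lim_imp_Limsup) auto
  then show ?thesis using s by (simp add: zero_ereal_def)
next
  case False
  \<comment> \<open>Above \<open>exp 1\<close> the inner logarithm is at least 1, so the clipping
    \<open>max 1\<close> has no effect.\<close>
  then have "eventually (\<lambda>r. exp 1 < nevanlinna_T r f) at_top"
    by (simp add: not_frequently not_le)
  then have "eventually (\<lambda>r. ereal (\<alpha> ((ln ^^ 2) (nevanlinna_T r f)) / \<beta> (ln (\<gamma> r))) =
      ereal (\<alpha> (ln (max 1 (ln (nevanlinna_T r f)))) / \<beta> (ln (\<gamma> r)))) at_top"
  proof eventually_elim
    case (elim r)
    then have "1 \<le> ln (nevanlinna_T r f)"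
      by (simp add: ln_ge_iff less_le_trans[OF exp_gt_zero less_imp_le])
    then have "max 1 (ln (nevanlinna_T r f)) = ln (nevanlinna_T r f)" by simp
    then show ?case by (simp add: numeral_2_eq_2)
  qed
  from Limsup_eq[OF this] le show ?thesis by (simp add: abg_log_order_def)
qed

theorem theorem3:
  fixes \<alpha> \<beta> \<gamma> :: "real \<Rightarrow> real"
    and k :: nat
    and A :: "nat \<Rightarrow> complex \<Rightarrow> complex"
    and f :: "complex \<Rightarrow> complex"
  assumes "\<alpha> \<in> class_L1" and "\<beta> \<in> class_L2" and "\<gamma> \<in> class_L3"
    and "\<And>p :: nat. p \<ge> 2 \<Longrightarrow> (\<lambda>x. \<alpha> ((ln ^^ p) x)) \<in> o[at_top](\<lambda>x. \<beta> (ln (\<gamma> x)))"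
    and "(\<lambda>x. \<alpha> (ln x)) \<in> o[at_top](\<alpha>)"
    and "\<And>\<kappa> :: real. 0 < \<kappa> \<Longrightarrow> \<kappa> < 1 \<Longrightarrow> (\<lambda>x. inv \<alpha> (\<kappa> * x)) \<in> o[at_top](inv \<alpha>)"
    and "k \<ge> 2"
    and "\<And>j. j < k \<Longrightarrow> A j holomorphic_on UNIV"
    and "abg_order \<alpha> \<beta> \<gamma> (A 0) > Max ((\<lambda>j. abg_order \<alpha> \<beta> \<gamma> (A j)) ` {1..k - 1})"
    and "f holomorphic_on UNIV" and "\<exists>z. f z \<noteq> 0"
    and "\<And>z. (deriv ^^ k) f z + (\<Sum>j<k. A j z * (deriv ^^ j) f z) = 0"
  shows "abg_log_order \<alpha> \<beta> \<gamma> f = abg_order \<alpha> \<beta> \<gamma> (A 0)"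
proof -
  note \<alpha> = assms(1) and \<beta> = assms(2) and \<gamma> = assms(3) and A = assms(8) and f = assms(10)
    and ode = assms(12)
  have L: "\<alpha> \<in> class_L" "\<beta> \<in> class_L" "\<gamma> \<in> class_L"
    using \<alpha> \<beta> \<gamma> by (auto simp: class_L1_def class_L2_def class_L3_def)
  have k: "0 < k" using assms(7) by simp
  have small: "(\<lambda>r. \<alpha> (ln (ln r))) \<in> o[at_top](\<lambda>r. \<beta> (ln (\<gamma> r)))"
    using assms(4)[of 2] by (simp add: numeral_2_eq_2)
  define M where "M = Max ((\<lambda>j. abg_order \<alpha> \<beta> \<gamma> (A j)) ` {1..k - 1})"
  have M_ge: "abg_order \<alpha> \<beta> \<gamma> (A j) \<le> M" if "1 \<le> j" "j < k" for j
    unfolding M_def using that by (intro Max_ge) auto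
  have M_less: "M < abg_order \<alpha> \<beta> \<gamma> (A 0)" using assms(9) by (simp add: M_def)
  have s0: "0 \<le> abg_order \<alpha> \<beta> \<gamma> (A 0)" by (rule abg_order_nonneg[OF L(1,2)])
  show ?thesis
  proof (rule antisym)
    obtain C where C: "0 \<le> C" "\<And>r. 1 \<le> r \<Longrightarrow> ln (nevanlinna_T r f) \<le>
       C * (1 + ln r + (\<Sum>j<k. max 1 (nevanlinna_T (2 * r) (A j))))"
      using ln_nevanlinna_T_solution_le[OF A f k ode] by blast
    have ev: "eventually (\<lambda>r. ln (nevanlinna_T r f) \<le>
       C * (1 + ln r + (\<Sum>j<k. max 1 (nevanlinna_T (real 2 * r) (A j))))) at_top"
      using eventually_ge_at_top[of 1] by eventually_elim (use C(2) in simp)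
    show "abg_log_order \<alpha> \<beta> \<gamma> f \<le> abg_order \<alpha> \<beta> \<gamma> (A 0)"
    proof (rule abg_log_order_le_max[OF L f s0],
        rule Limsup_order_ratio_le[OF \<alpha> \<beta> \<gamma> small finite_lessThan _ C(1) ev _ s0])
      fix j assume "j \<in> {..<k}"
      then have "abg_order \<alpha> \<beta> \<gamma> (A j) \<le> abg_order \<alpha> \<beta> \<gamma> (A 0)"
        using M_ge[of j] M_less by (cases "j = 0") auto
      then show "Limsup at_top (\<lambda>r. ereal (\<alpha> (ln (nevanlinna_T r (A j))) / \<beta> (ln (\<gamma> r))))
          \<le> abg_order \<alpha> \<beta> \<gamma> (A 0)"
        by (simp add: abg_order_def)
    qed simp
  next
    obtain c where c: "f c \<noteq> 0" using assms(11) by blast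
    obtain C where C: "0 \<le> C" "\<And>r. max 8 (norm c) \<le> r \<Longrightarrow> nevanlinna_T r (A 0) \<le>
       C * (1 + ln r + ((\<Sum>j=1..<k. max 1 (nevanlinna_T (100 * r) (A j))) +
          max 1 (ln (nevanlinna_T (100 * r) f))))"
      using nevanlinna_T_coefficient_le[OF A f k c ode] by blast
    \<comment> \<open>Index 0 is free, since \<open>A 0\<close> stands on the left of the estimate;
      it holds the logarithmic characteristic of \<open>f\<close>.\<close>
    define V where "V = (\<lambda>j r. if j = 0 then ln (nevanlinna_T r f) else nevanlinna_T r (A j))"
    define s where "s = max M (abg_log_order \<alpha> \<beta> \<gamma> f)"
    have sum_V: "(\<Sum>j<k. max 1 (V j x)) =
        (\<Sum>j=1..<k. max 1 (nevanlinna_T x (A j))) + max 1 (ln (nevanlinna_T x f))" for x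
    proof -
      have "(\<Sum>j<k. max 1 (V j x)) = max 1 (V 0 x) + (\<Sum>j=1..<k. max 1 (V j x))"
        using k by (simp add: lessThan_atLeast0 sum.atLeast_Suc_lessThan)
      also have "(\<Sum>j=1..<k. max 1 (V j x)) = (\<Sum>j=1..<k. max 1 (nevanlinna_T x (A j)))"
        by (intro sum.cong) (auto simp: V_def)
      finally show ?thesis by (simp add: V_def)
    qed
    have ev: "eventually (\<lambda>r. nevanlinna_T r (A 0) \<le>
       C * (1 + ln r + (\<Sum>j<k. max 1 (V j (real 100 * r))))) at_top"
      using eventually_ge_at_top[of "max 8 (norm c)"]
      by eventually_elim (use C(2) in \<open>simp add: sum_V\<close>)
    \<comment> \<open>As \<open>k \<ge> 2\<close>, the coefficient \<open>A 1\<close> is among those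
      in the maximum.\<close>
    have "0 \<le> M" using M_ge[of 1] abg_order_nonneg[OF L(1,2)] assms(7) order_trans
      by fastforce
    then have s: "0 \<le> s" by (simp add: s_def le_max_iff_disj)
    have "abg_order \<alpha> \<beta> \<gamma> (A 0) \<le>
        Limsup at_top (\<lambda>r. ereal (\<alpha> (ln (max 1 (nevanlinna_T r (A 0)))) / \<beta> (ln (\<gamma> r))))"
      unfolding abg_order_def
    proof (rule Limsup_mono, rule always_eventually, rule allI)
      fix r
      \<comment> \<open>Clipping at 1 only enlarges the numerator; the default
        \<open>ln 0 = 0\<close> agrees with \<open>ln 1\<close>.\<close>
      have "ln (nevanlinna_T r (A 0)) \<le> ln (max 1 (nevanlinna_T r (A 0)))"
        using nevanlinna_T_nonneg[OF A[OF k], of r]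
        by (cases "nevanlinna_T r (A 0) = 0") (auto intro: ln_mono)
      then show "ereal (\<alpha> (ln (nevanlinna_T r (A 0))) / \<beta> (ln (\<gamma> r))) \<le>
          ereal (\<alpha> (ln (max 1 (nevanlinna_T r (A 0)))) / \<beta> (ln (\<gamma> r)))"
        using class_L_nonneg[OF L(2)] monoD[OF class_L_mono[OF L(1)]]
        by (simp add: divide_right_mono)
    qed
    also have "\<dots> \<le> s"
    proof (rule Limsup_order_ratio_le[OF \<alpha> \<beta> \<gamma> small finite_lessThan _ C(1) ev _ s])
      fix j assume j: "j \<in> {..<k}"
      show "Limsup at_top (\<lambda>r. ereal (\<alpha> (ln (V j r)) / \<beta> (ln (\<gamma> r)))) \<le> s"
      proof (cases "j = 0")
        case True
        then show ?thesis
          by (simp add: V_def s_def abg_log_order_def numeral_2_eq_2 le_max_iff_disj)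
      next
        case False
        then show ?thesis
          using M_ge[of j] j by (simp add: V_def s_def abg_order_def le_max_iff_disj)
      qed
    qed simp
    \<comment> \<open>The order of \<open>A 0\<close> is at most the maximum \<open>s\<close> but
      exceeds \<open>M\<close>, so the other entry of the maximum must bound it.\<close>
    finally show "abg_order \<alpha> \<beta> \<gamma> (A 0) \<le> abg_log_order \<alpha> \<beta> \<gamma> f"
      using M_less by (auto simp: s_def le_max_iff_disj)
  qed
qed

end
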